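(* Let $P(\lambda)=\ell(\lambda)\sum_{i=1}^{k+1}P_i\frac{w_i}{\gamma_i(\lambda)}$, $P_i\in\mathbb{C}^{n\times n}$, be an $n\times n$ regular matrix polynomial (of grade $k$) expressed in the modified Lagrange basis associated with nodes $x_1,\ldots,x_{k+1}$, and let $\lambda_0$ be an eigenvalue (finite or infinite) of $P(\lambda)$. Let $0\le\mu\le k-1$, $A\in\mathbb{C}^{(\mu+1)n\times(k-\mu-1)n}$, $B\in\mathbb{C}^{\mu n\times(k-\mu)n}$, and let $$L(\lambda)=\begin{bmatrix}M_\mu^L(\lambda)+AK_1^L(\lambda)+K_2^L(\lambda)^TB&K_2^L(\lambda)^T\\ K_1^L(\lambda)&0\end{bmatrix}.$$ Let $z$ and $\omega$ be, respectively, a right and a left eigenvector of $L(\lambda)$ associated with $\lambda_0$, regarded as block vectors with $k$ block entries $z(i),\omega(i)$ of length $n$. 1. Assume $\lambda_0$ is finite and $\lambda_0\notin\{x_1,x_2,\ldots,x_{k+1}\}$. Then the block entries $z(1),z(2),\ldots,z(k-\mu)$ are right eigenvectors of $P(\lambda)$ associated with $\lambda_0$, and the block entries $\omega(1),\omega(2),\ldots,\omega(\mu+1)$ are left eigenvectors of $P(\lambda)$ associated with $\lambda_0$. 2. Assume $\lambda_0$ is infinite. Then the block entries $z(1),z(2),\ldots,z(k-\mu)$ are right eigenvectors of $P(\lambda)$ associated with $\lambda_0$, and the block entries $\omega(1),\omega(2),\ldots,\omega(\mu+1)$ are left eigenvectors of $P(\lambda)$ associated with $\lambda_0$.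
   Context: Lagrange setting (here $m=n$). Let $k\ge1$ and let $x_1,\ldots,x_{k+1}\in\mathbb{C}$ be distinct nodes. Put $\gamma_i(\lambda)=\lambda-x_i$, $\ell(\lambda)=\prod_{i=1}^{k+1}(\lambda-x_i)$, $w_i=1/\prod_{j\ne i}(x_i-x_j)$. For $0\le\mu\le k-1$, $$K_1^L(\lambda)=\begin{bmatrix}\gamma_{k+1}I_n&-\gamma_{k-1}I_n\\&\gamma_kI_n&-\gamma_{k-2}I_n\\&&\ddots&\ddots\\&&&\gamma_{\mu+3}I_n&-\gamma_{\mu+1}I_n\end{bmatrix},\quad K_2^L(\lambda)=\begin{bmatrix}\gamma_{\mu+2}I_n&-\gamma_{\mu}I_n\\&\gamma_{\mu+1}I_n&-\gamma_{\mu-1}I_n\\&&\ddots&\ddots\\&&&\gamma_3I_n&-\gamma_1I_n\end{bmatrix},$$ of sizes $(k-\mu-1)n\times(k-\mu)n$ and $\mu n\times(\mu+1)n$ ($K_1^L$ is empty if $\mu=k-1$, $K_2^L$ is empty if $\mu=0$). $M_\mu^L(\lambda)$ is the $(\mu+1)\times(k-\mu)$ block pencil with $n\times n$ blocks: if $\mu<k-1$, its first block row is $[P_{k+1}w_{k+1}\gamma_k+P_kw_k\gamma_{k+1},\ P_{k-1}w_{k-1}\gamma_k,\ldots,P_{\mu+1}w_{\mu+1}\gamma_{\mu+2}]$, its last block column has, from top to bottom, blocks $P_{\mu+1}w_{\mu+1}\gamma_{\mu+2},P_\mu w_\mu\gamma_{\mu+1},\ldots,P_2w_2\gamma_3,P_1w_1\gamma_2$,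 and all other blocks are $0$; if $\mu=k-1$, it is the block column with blocks $P_{k+1}w_{k+1}\gamma_k+P_kw_k\gamma_{k+1},\ P_{k-1}w_{k-1}\gamma_k,\ldots,P_2w_2\gamma_3,P_1w_1\gamma_2$. A square matrix polynomial is regular if its determinant is not identically zero. $\lambda_0\in\mathbb{C}$ is a finite eigenvalue of $P$ if $P(\lambda_0)$ is singular; a right (left) eigenvector is a nonzero $x$ with $P(\lambda_0)x=0$ (nonzero $y$ with $y^TP(\lambda_0)=0$, plain transpose). For $P$ of grade $k$, $\mathrm{rev}_kP(\lambda)=\lambda^kP(1/\lambda)$; $P$ has an infinite eigenvalue if $0$ is an eigenvalue of $\mathrm{rev}_kP$, and the associated right/left eigenvectors are those of $\mathrm{rev}_kP$ at $0$. For a pencil the same definitions are used with $k$ replaced by $1$. *)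

theory Defs
  imports "Jordan_Normal_Form.Determinant"
begin

section \<open>Matrix polynomials and their finite and infinite eigenvalues\<close>

text \<open>A complex matrix polynomial is a matrix over the ring of complex polynomials.\<close>

type_synonym matpoly = "complex poly mat"

definition const_mp :: "complex mat \<Rightarrow> matpoly" where
  "const_mp A = map_mat (\<lambda>c. [:c:]) A"

definition eval_mp :: "matpoly \<Rightarrow> complex \<Rightarrow> complex mat" where
  "eval_mp Q a = map_mat (\<lambda>p. poly p a) Q"

text \<open>
  Reversal with respect to a prescribed grade \<open>g\<close>, which may exceed the degree (so
  \<open>reflect_poly\<close> cannot be used): the polynomial \<open>t ^ g * p (1 / t)\<close>.  It is meant for
  polynomials of degree at most \<open>g\<close>; see the lemma \<open>poly_rev_grade\<close>.
\<close>

definition rev_grade :: "nat \<Rightarrow> complex poly \<Rightarrow> complex poly" where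
  "rev_grade g p = (\<Sum>i\<le>g. monom (coeff p i) (g - i))"

definition rev_mp :: "nat \<Rightarrow> matpoly \<Rightarrow> matpoly" where
  "rev_mp g Q = map_mat (rev_grade g) Q"

lemma poly_rev_grade:
  assumes "degree p \<le> g" and "t \<noteq> 0"
  shows "poly (rev_grade g p) t = t ^ g * poly p (1 / t)"
proof -
  have "poly p (1 / t) = (\<Sum>i\<le>g. coeff p i * (1 / t) ^ i)"
    unfolding poly_altdef using assms(1)
    by (intro sum.mono_neutral_left) (auto simp: coeff_eq_0)
  then have "t ^ g * poly p (1 / t) = (\<Sum>i\<le>g. coeff p i * (t ^ g * (1 / t) ^ i))"
    by (simp add: sum_distrib_left algebra_simps)
  also have "\<dots> = (\<Sum>i\<le>g. coeff p i * t ^ (g - i))"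
    using assms(2) by (intro sum.cong) (auto simp: power_diff power_one_over divide_simps)
  finally show ?thesis
    by (simp add: rev_grade_def poly_sum poly_monom)
qed

definition regular_mp :: "matpoly \<Rightarrow> bool" where
  "regular_mp Q \<longleftrightarrow> square_mat Q \<and> det Q \<noteq> 0"

datatype ext_complex = Finite complex | Infinite

text \<open>
  The complex matrix whose kernels define the eigenvectors of a matrix polynomial of grade \<open>g\<close>
  at a point of the extended plane: the value at a finite point, and the value at \<open>0\<close> of the
  grade \<open>g\<close> reversal at infinity.
\<close>

fun value_mp :: "nat \<Rightarrow> matpoly \<Rightarrow> ext_complex \<Rightarrow> complex mat" where
  "value_mp g Q (Finite a) = eval_mp Q a"
| "value_mp g Q Infinite = eval_mp (rev_mp g Q) 0"

definition eigenvalue_mp :: "nat \<Rightarrow> matpoly \<Rightarrow> ext_complex \<Rightarrow> bool" where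
  "eigenvalue_mp g Q a \<longleftrightarrow> square_mat Q \<and> \<not> invertible_mat (value_mp g Q a)"

definition right_eigenvector_mp :: "nat \<Rightarrow> matpoly \<Rightarrow> ext_complex \<Rightarrow> complex vec \<Rightarrow> bool" where
  "right_eigenvector_mp g Q a v \<longleftrightarrow>
     v \<in> carrier_vec (dim_col Q) \<and> v \<noteq> 0\<^sub>v (dim_col Q) \<and>
     value_mp g Q a *\<^sub>v v = 0\<^sub>v (dim_row Q)"

text \<open>Left eigenvectors use the plain transpose: \<open>v\<^sup>T Q = 0\<close> is stated as \<open>Q\<^sup>T v = 0\<close>.\<close>

definition left_eigenvector_mp :: "nat \<Rightarrow> matpoly \<Rightarrow> ext_complex \<Rightarrow> complex vec \<Rightarrow> bool" where
  "left_eigenvector_mp g Q a v \<longleftrightarrow>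
     v \<in> carrier_vec (dim_row Q) \<and> v \<noteq> 0\<^sub>v (dim_row Q) \<and>
     transpose_mat (value_mp g Q a) *\<^sub>v v = 0\<^sub>v (dim_col Q)"


section \<open>Block matrices\<close>

text \<open>
  Blocks are numbered from \<open>1\<close>, whereas matrix and vector entries are numbered from \<open>0\<close>.
  In \<open>block_mat n p q F\<close>, the block \<open>F i j\<close> should be an \<open>n \<times> n\<close> matrix for
  \<open>1 \<le> i \<le> p\<close> and \<open>1 \<le> j \<le> q\<close>.
\<close>

definition block_mat :: "nat \<Rightarrow> nat \<Rightarrow> nat \<Rightarrow> (nat \<Rightarrow> nat \<Rightarrow> 'a mat) \<Rightarrow> 'a mat" where
  "block_mat n p q F =
     mat (p * n) (q * n) (\<lambda>(r, c). F (r div n + 1) (c div n + 1) $$ (r mod n, c mod n))"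

definition block_entry :: "nat \<Rightarrow> 'a vec \<Rightarrow> nat \<Rightarrow> 'a vec" where
  "block_entry n v i = vec n (\<lambda>r. v $ ((i - 1) * n + r))"


section \<open>The modified Lagrange basis\<close>

text \<open>The nodes are \<open>x 1, \<dots>, x (k + 1)\<close>; other values of \<open>x\<close> are irrelevant.\<close>

definition gam :: "(nat \<Rightarrow> complex) \<Rightarrow> nat \<Rightarrow> complex poly" where
  "gam x i = [:- x i, 1:]"

definition ell :: "(nat \<Rightarrow> complex) \<Rightarrow> nat \<Rightarrow> complex poly" where
  "ell x k = (\<Prod>i\<in>{1..k+1}. gam x i)"

definition bary_weight :: "(nat \<Rightarrow> complex) \<Rightarrow> nat \<Rightarrow> nat \<Rightarrow> complex" where
  "bary_weight x k i = 1 / (\<Prod>j\<in>{1..k+1} - {i}. x i - x j)"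

text \<open>
  The matrix polynomial \<open>\<ell> * (\<Sum>i. P\<^sub>i * w\<^sub>i / \<gamma>\<^sub>i)\<close>.  Each \<open>\<gamma>\<^sub>i\<close> divides \<open>\<ell>\<close>, so the polynomial
  division below is exact; see the lemma \<open>poly_lagrange_mp\<close>.
\<close>

definition lagrange_mp :: "nat \<Rightarrow> nat \<Rightarrow> (nat \<Rightarrow> complex) \<Rightarrow> (nat \<Rightarrow> complex mat) \<Rightarrow> matpoly" where
  "lagrange_mp n k x P = mat n n (\<lambda>(r, c).
     \<Sum>i\<in>{1..k+1}. smult (P i $$ (r, c) * bary_weight x k i) (ell x k div gam x i))"

lemma gam_nonzero: "gam x i \<noteq> 0"
  by (simp add: gam_def)

lemma ell_div_gam:
  assumes "i \<in> {1..k+1}"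
  shows "ell x k div gam x i = (\<Prod>j\<in>{1..k+1} - {i}. gam x j)"
proof -
  have "ell x k = gam x i * (\<Prod>j\<in>{1..k+1} - {i}. gam x j)"
    unfolding ell_def using assms by (intro prod.remove) auto
  then show ?thesis
    by (simp add: gam_nonzero)
qed

lemma poly_lagrange_mp:
  assumes "r < n" and "c < n" and "a \<notin> x ` {1..k+1}"
  shows "poly (lagrange_mp n k x P $$ (r, c)) a =
    poly (ell x k) a * (\<Sum>i\<in>{1..k+1}. P i $$ (r, c) * bary_weight x k i / poly (gam x i) a)"
proof -
  have q: "poly (ell x k div gam x i) a = poly (ell x k) a / poly (gam x i) a"
    if i: "i \<in> {1..k+1}" for i
  proof -
    have "ell x k = gam x i * (ell x k div gam x i)"
      using prod.remove[of "{1..k+1}" i "gam x"] i by (simp add: ell_div_gam ell_def)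
    then have "poly (ell x k) a = poly (gam x i) a * poly (ell x k div gam x i) a"
      by (metis poly_mult)
    moreover have "poly (gam x i) a \<noteq> 0"
      using assms(3) i by (auto simp: gam_def)
    ultimately show ?thesis
      by simp
  qed
  show ?thesis
    using assms(1,2) by (simp add: lagrange_mp_def poly_sum sum_distrib_left q algebra_simps)
qed

lemma degree_lagrange_mp:
  assumes "r < n" and "c < n"
  shows "degree (lagrange_mp n k x P $$ (r, c)) \<le> k"
proof -
  have "degree (ell x k div gam x i) \<le> k" if i: "i \<in> {1..k+1}" for i
  proof -
    have "degree (\<Prod>j\<in>{1..k+1} - {i}. gam x j) \<le> (\<Sum>j\<in>{1..k+1} - {i}. degree (gam x j))"
      using degree_prod_sum_le[of "{1..k+1} - {i}" "gam x"] by (simp add: o_def)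
    then show ?thesis
      unfolding ell_div_gam[OF i] using i by (simp add: gam_def)
  qed
  then have "degree (\<Sum>i\<in>{1..k+1}. smult (P i $$ (r, c) * bary_weight x k i) (ell x k div gam x i)) \<le> k"
    by (intro degree_sum_le order.trans[OF degree_smult_le]) auto
  then show ?thesis
    using assms by (simp add: lagrange_mp_def)
qed


section \<open>The block Kronecker pencils in the modified Lagrange basis\<close>

text \<open>
  In block row \<open>i\<close> the diagonal block is \<open>\<gamma>\<^bsub>k+2-i\<^esub> I\<^sub>n\<close> in the first pencil and \<open>\<gamma>\<^bsub>\<mu>+3-i\<^esub> I\<^sub>n\<close>
  in the second one.
\<close>

definition K1Lag :: "nat \<Rightarrow> nat \<Rightarrow> nat \<Rightarrow> (nat \<Rightarrow> complex) \<Rightarrow> matpoly" where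
  "K1Lag n k \<mu> x = block_mat n (k - \<mu> - 1) (k - \<mu>) (\<lambda>i j.
     if j = i then gam x (k + 2 - i) \<cdot>\<^sub>m 1\<^sub>m n
     else if j = i + 1 then (- gam x (k - i)) \<cdot>\<^sub>m 1\<^sub>m n
     else 0\<^sub>m n n)"

definition K2Lag :: "nat \<Rightarrow> nat \<Rightarrow> (nat \<Rightarrow> complex) \<Rightarrow> matpoly" where
  "K2Lag n \<mu> x = block_mat n \<mu> (\<mu> + 1) (\<lambda>i j.
     if j = i then gam x (\<mu> + 3 - i) \<cdot>\<^sub>m 1\<^sub>m n
     else if j = i + 1 then (- gam x (\<mu> + 1 - i)) \<cdot>\<^sub>m 1\<^sub>m n
     else 0\<^sub>m n n)"

definition Pwg :: "nat \<Rightarrow> (nat \<Rightarrow> complex) \<Rightarrow> (nat \<Rightarrow> complex mat) \<Rightarrow> nat \<Rightarrow> nat \<Rightarrow> matpoly" where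
  "Pwg k x P i j = gam x j \<cdot>\<^sub>m const_mp (bary_weight x k i \<cdot>\<^sub>m P i)"

text \<open>
  The first block row carries \<open>P\<^bsub>k+1-j\<^esub> w\<^bsub>k+1-j\<^esub> \<gamma>\<^bsub>k+2-j\<^esub>\<close> in block column \<open>j \<ge> 2\<close>, and the last
  block column carries \<open>P\<^bsub>\<mu>+2-i\<^esub> w\<^bsub>\<mu>+2-i\<^esub> \<gamma>\<^bsub>\<mu>+3-i\<^esub>\<close> in block row \<open>i\<close>; the two formulas agree at
  \<open>(1, k - \<mu>)\<close> when \<open>\<mu> < k - 1\<close>.  For \<open>\<mu> = k - 1\<close> there is a single block column, the block
  \<open>(1, 1)\<close> is the two-term one, and the last branch gives \<open>P\<^bsub>k+1-i\<^esub> w\<^bsub>k+1-i\<^esub> \<gamma>\<^bsub>k+2-i\<^esub>\<close> below it, so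
  both cases are covered.
\<close>

definition MLag :: "nat \<Rightarrow> nat \<Rightarrow> nat \<Rightarrow> (nat \<Rightarrow> complex) \<Rightarrow> (nat \<Rightarrow> complex mat) \<Rightarrow> matpoly" where
  "MLag n k \<mu> x P = block_mat n (\<mu> + 1) (k - \<mu>) (\<lambda>i j.
     if i = 1 \<and> j = 1 then Pwg k x P (k + 1) k + Pwg k x P k (k + 1)
     else if i = 1 then Pwg k x P (k + 1 - j) (k + 2 - j)
     else if j = k - \<mu> then Pwg k x P (\<mu> + 2 - i) (\<mu> + 3 - i)
     else 0\<^sub>m n n)"

definition lagrange_pencil ::
    "nat \<Rightarrow> nat \<Rightarrow> nat \<Rightarrow> (nat \<Rightarrow> complex) \<Rightarrow> (nat \<Rightarrow> complex mat) \<Rightarrow> complex mat \<Rightarrow> complex mat \<Rightarrow> matpoly"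
  where
  "lagrange_pencil n k \<mu> x P A B = four_block_mat
     (MLag n k \<mu> x P + const_mp A * K1Lag n k \<mu> x + transpose_mat (K2Lag n \<mu> x) * const_mp B)
     (transpose_mat (K2Lag n \<mu> x))
     (K1Lag n k \<mu> x)
     (0\<^sub>m ((k - \<mu> - 1) * n) (\<mu> * n))"

end

theory Submission
  imports Defs
begin

text \<open>
  Let \<open>g\<^sub>i\<close> be the value of \<open>\<gamma>\<^sub>i\<close> at a finite point off the nodes, or its leading coefficient \<open>1\<close> at
  infinity; in both cases all \<open>g\<^sub>i\<close> are nonzero.  The kernel of the bidiagonal pencil \<open>K\<^sub>1\<close> at
  this point is then the range of the block column \<open>C\<close> with blocks
  \<open>g\<^bsub>k+1\<^esub> g\<^sub>k / (g\<^bsub>k+2-j\<^esub> g\<^bsub>k+1-j\<^esub>) I\<^sub>n\<close>, and \<open>K\<^sub>2\<close> has an analogous block column \<open>D\<close>.  The last block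
  rows of \<open>L z = 0\<close> give \<open>(z(1), \<dots>, z(k-\<mu>)) = C v\<close>, and multiplying the first block rows by
  \<open>D\<^sup>T\<close> leaves \<open>D\<^sup>T M C v = 0\<close>, where \<open>D\<^sup>T M C\<close> is a nonzero multiple of
  \<open>\<Sum>i. P\<^sub>i w\<^sub>i / g\<^sub>i\<close>, hence of \<open>P\<close>.  If \<open>v = 0\<close>, then \<open>z = 0\<close> because \<open>K\<^sub>2\<^sup>T\<close> is injective.
  Transposing \<open>L\<close> exchanges the roles of \<open>K\<^sub>1\<close> and \<open>K\<^sub>2\<close>, which gives the left eigenvectors.
\<close>

section \<open>Block indices, block matrices and block vectors\<close>

lemma sum_blocks:
  fixes f :: "nat \<Rightarrow> 'a::comm_monoid_add"
  shows "(\<Sum>c<q * n. f c) = (\<Sum>j=1..q. \<Sum>s<n. f ((j - 1) * n + s))"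
proof -
  have "(\<Sum>c<q * n. f c) = (\<Sum>m<q. \<Sum>c=m * n..<m * n + n. f c)"
    by (rule sum.nat_group[symmetric])
  also have "\<dots> = (\<Sum>m<q. \<Sum>s<n. f (m * n + s))"
  proof (rule sum.cong[OF refl])
    fix m
    show "(\<Sum>c=m * n..<m * n + n. f c) = (\<Sum>s<n. f (m * n + s))"
      by (rule sum.reindex_bij_witness[of _ "\<lambda>s. m * n + s" "\<lambda>c. c - m * n"]) auto
  qed
  also have "\<dots> = (\<Sum>j=1..q. \<Sum>s<n. f ((j - 1) * n + s))"
    by (rule sum.reindex_bij_witness[of _ "\<lambda>j. j - 1" "\<lambda>m. m + 1"]) auto
  finally show ?thesis .
qed

lemma block_index_less:
  fixes i p r n :: nat
  assumes "i \<in> {1..p}" and "r < n"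
  shows "(i - 1) * n + r < p * n"
proof -
  have "(i - 1) * n + r < i * n"
    using assms by (cases i) auto
  also have "\<dots> \<le> p * n"
    using assms by simp
  finally show ?thesis .
qed

lemma block_index_div_mod:
  fixes i r n :: nat
  assumes "i \<ge> 1" and "r < n"
  shows "((i - 1) * n + r) div n + 1 = i" and "((i - 1) * n + r) mod n = r"
  using assms by simp_all

lemma block_index_cases:
  fixes c p n :: nat
  assumes "c < p * n"
  obtains i r where "i \<in> {1..p}" and "r < n" and "c = (i - 1) * n + r"
proof
  \<comment> \<open>An index below \<open>p * n\<close> exists only if \<open>n > 0\<close>, which
    excludes the default values of division by zero.\<close>
  show "c mod n < n" using assms by (cases n) auto
  show "c div n + 1 \<in> {1..p}"
    using assms by (simp add: less_mult_imp_div_less Suc_leI)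
qed simp

lemma block_mat_carrier [simp]: "block_mat n p q F \<in> carrier_mat (p * n) (q * n)"
  by (simp add: block_mat_def)

lemma block_mat_dim [simp]:
  "dim_row (block_mat n p q F) = p * n" "dim_col (block_mat n p q F) = q * n"
  by (simp_all add: block_mat_def)

lemma block_mat_index:
  assumes "i \<in> {1..p}" and "r < n" and "j \<in> {1..q}" and "s < n"
  shows "block_mat n p q F $$ ((i - 1) * n + r, (j - 1) * n + s) = F i j $$ (r, s)"
  using assms block_index_less[OF assms(1,2)] block_index_less[OF assms(3,4)]
  by (simp add: block_mat_def block_index_div_mod del: One_nat_def)

lemma block_mat_1_1_index:
  assumes "r < n" and "s < n"
  shows "block_mat n 1 1 F $$ (r, s) = F 1 1 $$ (r, s)"
  using assms block_mat_index[of 1 1 r n 1 1 s F] by simp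

lemma eq_block_matI:
  assumes "X \<in> carrier_mat (p * n) (q * n)"
    and "\<And>i r j s. \<lbrakk>i \<in> {1..p}; r < n; j \<in> {1..q}; s < n\<rbrakk> \<Longrightarrow>
      X $$ ((i - 1) * n + r, (j - 1) * n + s) = F i j $$ (r, s)"
  shows "X = block_mat n p q F"
proof (rule eq_matI)
  fix a b assume "a < dim_row (block_mat n p q F)" "b < dim_col (block_mat n p q F)"
  then have "a < p * n" "b < q * n" by simp_all
  then obtain i r j s where "i \<in> {1..p}" "r < n" "a = (i - 1) * n + r"
    "j \<in> {1..q}" "s < n" "b = (j - 1) * n + s"
    by (metis block_index_cases)
  then show "X $$ (a, b) = block_mat n p q F $$ (a, b)"
    using assms(2) block_mat_index[of i p r n j q s F] by simp
qed (use assms(1) in auto)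

text \<open>Only the entries of a block with indices below \<open>n\<close> enter
  \<open>block_mat\<close>, so blocks may be exchanged for any others that agree there, whatever
  their formal dimensions.\<close>

lemma block_mat_cong:
  assumes "\<And>i j r s. \<lbrakk>i \<in> {1..p}; j \<in> {1..q}; r < n; s < n\<rbrakk> \<Longrightarrow> F i j $$ (r, s) = G i j $$ (r, s)"
  shows "block_mat n p q F = block_mat n p q G"
  by (intro eq_block_matI) (auto simp: block_mat_index assms simp del: One_nat_def)

lemma block_entry_dim [simp]: "block_entry n v i \<in> carrier_vec n" "dim_vec (block_entry n v i) = n"
  by (simp_all add: block_entry_def)

lemma eq_vec_blocksI:
  assumes "u \<in> carrier_vec (p * n)" and "v \<in> carrier_vec (p * n)"
    and "\<And>i. i \<in> {1..p} \<Longrightarrow> block_entry n u i = block_entry n v i"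
  shows "u = v"
proof (rule eq_vecI)
  fix c assume "c < dim_vec v"
  then have "c < p * n" using assms by auto
  then obtain i r where "i \<in> {1..p}" "r < n" "c = (i - 1) * n + r"
    by (metis block_index_cases)
  then show "u $ c = v $ c"
    using arg_cong[OF assms(3)[of i], of "\<lambda>w. w $ r"] by (simp add: block_entry_def)
qed (use assms in auto)

lemma block_entry_mult_block_mat_vec:
  assumes "i \<in> {1..p}" and "r < n" and "v \<in> carrier_vec (q * n)"
  shows "block_entry n (block_mat n p q F *\<^sub>v v) i $ r =
    (\<Sum>j=1..q. \<Sum>s<n. F i j $$ (r, s) * block_entry n v j $ s)"
proof -
  let ?a = "(i - 1) * n + r"
  have a: "?a < p * n" using assms by (intro block_index_less)
  have "block_entry n (block_mat n p q F *\<^sub>v v) i $ r = (block_mat n p q F *\<^sub>v v) $ ?a"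
    using assms by (simp add: block_entry_def)
  also have "\<dots> = (\<Sum>c<q * n. block_mat n p q F $$ (?a, c) * v $ c)"
    using a assms(3) by (auto simp: scalar_prod_def atLeast0LessThan intro!: sum.cong)
  also have "\<dots> = (\<Sum>j=1..q. \<Sum>s<n. F i j $$ (r, s) * block_entry n v j $ s)"
    unfolding sum_blocks using assms
    by (intro sum.cong refl) (auto simp: block_mat_index block_entry_def simp del: One_nat_def)
  finally show ?thesis .
qed

text \<open>Splitting the inner index into block number and offset turns the row-by-column sum into
  a double sum. The blocks of the product are spelled out entrywise, so that the identity holds for
  arbitrary block functions.\<close>

lemma block_mat_mult:
  "block_mat n p q F * block_mat n q m G = block_mat n p m
     (\<lambda>i j. mat n n (\<lambda>(r, s). \<Sum>l=1..q. \<Sum>t<n. F i l $$ (r, t) * G l j $$ (t, s)))"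
proof (rule eq_block_matI)
  fix i r j s assume ij: "i \<in> {1..p}" "r < n" "j \<in> {1..m}" "s < n"
  let ?a = "(i - 1) * n + r" and ?b = "(j - 1) * n + s"
  have ab: "?a < p * n" "?b < m * n" using ij by (blast intro: block_index_less)+
  have "(block_mat n p q F * block_mat n q m G) $$ (?a, ?b) =
      (\<Sum>c<q * n. block_mat n p q F $$ (?a, c) * block_mat n q m G $$ (c, ?b))"
    using ab by (auto simp: scalar_prod_def atLeast0LessThan intro!: sum.cong)
  also have "\<dots> = (\<Sum>l=1..q. \<Sum>t<n. F i l $$ (r, t) * G l j $$ (t, s))"
    unfolding sum_blocks using ij
    by (intro sum.cong refl) (auto simp: block_mat_index simp del: One_nat_def)
  finally show "(block_mat n p q F * block_mat n q m G) $$ (?a, ?b) =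
      mat n n (\<lambda>(r, s). \<Sum>l=1..q. \<Sum>t<n. F i l $$ (r, t) * G l j $$ (t, s)) $$ (r, s)"
    using ij by simp
qed (rule mult_carrier_mat[OF block_mat_carrier block_mat_carrier])

lemma transpose_block_mat:
  "transpose_mat (block_mat n p q F) = block_mat n q p (\<lambda>i j. mat n n (\<lambda>(r, s). F j i $$ (s, r)))"
  by (intro eq_block_matI)
    (auto simp: block_mat_index block_index_less simp del: One_nat_def)

section \<open>Blocks that are multiples of the identity\<close>

text \<open>This is the Kronecker product of the scalar matrix \<open>a\<close> with
  \<open>1\<^sub>m n\<close>. It acts on each of the \<open>n\<close> components of a block vector
  separately, so the block computations below reduce to scalar ones.\<close>

definition scalar_blocks :: "nat \<Rightarrow> nat \<Rightarrow> nat \<Rightarrow> (nat \<Rightarrow> nat \<Rightarrow> 'a) \<Rightarrow> 'a::comm_ring_1 mat" where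
  "scalar_blocks n p q a = block_mat n p q (\<lambda>i j. a i j \<cdot>\<^sub>m 1\<^sub>m n)"

lemma scalar_blocks_carrier [simp]: "scalar_blocks n p q a \<in> carrier_mat (p * n) (q * n)"
  by (simp add: scalar_blocks_def)

lemma scalar_blocks_dim [simp]:
  "dim_row (scalar_blocks n p q a) = p * n" "dim_col (scalar_blocks n p q a) = q * n"
  by (simp_all add: scalar_blocks_def)

lemma transpose_scalar_blocks:
  "transpose_mat (scalar_blocks n p q a) = scalar_blocks n q p (\<lambda>i j. a j i)"
  unfolding scalar_blocks_def transpose_block_mat by (rule block_mat_cong) auto

lemma block_entry_mult_scalar_blocks_vec:
  assumes "i \<in> {1..p}" and "r < n" and "v \<in> carrier_vec (q * n)"
  shows "block_entry n (scalar_blocks n p q a *\<^sub>v v) i $ r = (\<Sum>j=1..q. a i j * block_entry n v j $ r)"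
  unfolding scalar_blocks_def block_entry_mult_block_mat_vec[OF assms]
proof (rule sum.cong[OF refl])
  fix j
  have "(\<Sum>s<n. (a i j \<cdot>\<^sub>m 1\<^sub>m n) $$ (r, s) * block_entry n v j $ s) =
      (\<Sum>s<n. if r = s then a i j * block_entry n v j $ s else 0)"
    using assms by (intro sum.cong) auto
  then show "(\<Sum>s<n. (a i j \<cdot>\<^sub>m 1\<^sub>m n) $$ (r, s) * block_entry n v j $ s) = a i j * block_entry n v j $ r"
    using assms by simp
qed

lemma scalar_blocks_mult_block_mat:
  "scalar_blocks n p q a * block_mat n q m G =
   block_mat n p m (\<lambda>i j. mat n n (\<lambda>(r, s). \<Sum>l=1..q. a i l * G l j $$ (r, s)))"
  unfolding scalar_blocks_def block_mat_mult
proof (rule block_mat_cong)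
  fix i j r s assume rs: "r < n" "s < n"
  have "(\<Sum>t<n. (a i l \<cdot>\<^sub>m 1\<^sub>m n) $$ (r, t) * G l j $$ (t, s)) = a i l * G l j $$ (r, s)" for l
  proof -
    have "(\<Sum>t<n. (a i l \<cdot>\<^sub>m 1\<^sub>m n) $$ (r, t) * G l j $$ (t, s)) =
        (\<Sum>t<n. if r = t then a i l * G l j $$ (t, s) else 0)"
      using rs by (intro sum.cong) auto
    then show ?thesis using rs by simp
  qed
  then show "mat n n (\<lambda>(r, s). \<Sum>l=1..q. \<Sum>t<n. (a i l \<cdot>\<^sub>m 1\<^sub>m n) $$ (r, t) * G l j $$ (t, s)) $$ (r, s) =
      mat n n (\<lambda>(r, s). \<Sum>l=1..q. a i l * G l j $$ (r, s)) $$ (r, s)"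
    using rs by simp
qed

lemma block_mat_mult_scalar_blocks:
  "block_mat n p q F * scalar_blocks n q m a =
   block_mat n p m (\<lambda>i j. mat n n (\<lambda>(r, s). \<Sum>l=1..q. F i l $$ (r, s) * a l j))"
  unfolding scalar_blocks_def block_mat_mult
proof (rule block_mat_cong)
  fix i j r s assume rs: "r < n" "s < n"
  have "(\<Sum>t<n. F i l $$ (r, t) * (a l j \<cdot>\<^sub>m 1\<^sub>m n) $$ (t, s)) = F i l $$ (r, s) * a l j" for l
  proof -
    have "(\<Sum>t<n. F i l $$ (r, t) * (a l j \<cdot>\<^sub>m 1\<^sub>m n) $$ (t, s)) =
        (\<Sum>t<n. if t = s then F i l $$ (r, t) * a l j else 0)"
      using rs by (intro sum.cong) auto
    then show ?thesis using rs by simp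
  qed
  then show "mat n n (\<lambda>(r, s). \<Sum>l=1..q. \<Sum>t<n. F i l $$ (r, t) * (a l j \<cdot>\<^sub>m 1\<^sub>m n) $$ (t, s)) $$ (r, s) =
      mat n n (\<lambda>(r, s). \<Sum>l=1..q. F i l $$ (r, s) * a l j) $$ (r, s)"
    using rs by simp
qed

section \<open>Bidiagonal block matrices and their kernels\<close>

text \<open>The common shape of the two Kronecker pencils at a point:
  \<open>p = k - \<mu> - 1\<close> with \<open>t = k\<close> gives the first one,
  \<open>p = \<mu>\<close> with \<open>t = \<mu> + 1\<close> the second. The function
  \<open>g\<close> stands for the values of the linear factors.\<close>

definition bidiag :: "nat \<Rightarrow> nat \<Rightarrow> nat \<Rightarrow> (nat \<Rightarrow> 'a) \<Rightarrow> 'a::comm_ring_1 mat" where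
  "bidiag n p t g = scalar_blocks n p (p + 1) (\<lambda>i j.
     if j = i then g (t + 2 - i) else if j = i + 1 then - g (t - i) else 0)"

text \<open>
  The solution of the recurrence \<open>g\<^bsub>t+2-j\<^esub> c\<^sub>j = g\<^bsub>t-j\<^esub> c\<^bsub>j+1\<^esub>\<close> with \<open>c\<^sub>1 = 1\<close>: the product telescopes.
\<close>

definition dual_coeff :: "nat \<Rightarrow> (nat \<Rightarrow> 'a::field) \<Rightarrow> nat \<Rightarrow> 'a" where
  "dual_coeff t g j = g (t + 1) * g t / (g (t + 2 - j) * g (t + 1 - j))"

text \<open>If \<open>p < t\<close> and \<open>g\<close> does not vanish on \<open>{1..t+1}\<close>,
  multiplication by this single block column parametrizes the kernel of
  \<open>bidiag n p t g\<close>, with the first block as the parameter.\<close>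

definition dual_col :: "nat \<Rightarrow> nat \<Rightarrow> nat \<Rightarrow> (nat \<Rightarrow> 'a::field) \<Rightarrow> 'a mat" where
  "dual_col n p t g = scalar_blocks n (p + 1) 1 (\<lambda>i j. dual_coeff t g i)"

lemma bidiag_carrier [simp]: "bidiag n p t g \<in> carrier_mat (p * n) ((p + 1) * n)"
  unfolding bidiag_def by (rule scalar_blocks_carrier)

lemma dual_col_carrier [simp]: "dual_col n p t g \<in> carrier_mat ((p + 1) * n) n"
  unfolding dual_col_def using scalar_blocks_carrier[of n "p + 1" 1] by simp

lemma sum_bidiag_row:
  fixes g h :: "nat \<Rightarrow> 'a::comm_ring_1"
  assumes "i \<in> {1..p}"
  shows "(\<Sum>j=1..p+1. (if j = i then g (t + 2 - i) else if j = i + 1 then - g (t - i) else 0) * h j)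
    = g (t + 2 - i) * h i - g (t - i) * h (i + 1)"
proof -
  have "(\<Sum>j=1..p+1. (if j = i then g (t + 2 - i) else if j = i + 1 then - g (t - i) else 0) * h j)
     = (\<Sum>j\<in>{i, i + 1}. (if j = i then g (t + 2 - i) else if j = i + 1 then - g (t - i) else 0) * h j)"
    using assms by (intro sum.mono_neutral_right) auto
  then show ?thesis by simp
qed

text \<open>For \<open>j \<le> p + 1\<close> the smallest index that occurs is
  \<open>t + 1 - j \<ge> t - p \<ge> 1\<close>, so numerator and denominator are products of nonzero
  values.\<close>

lemma dual_coeff_nonzero:
  assumes "p < t" and "\<forall>i\<in>{1..t+1}. g i \<noteq> 0" and "j \<in> {1..p+1}"
  shows "dual_coeff t g j \<noteq> 0"
proof -
  have "t + 2 - j \<in> {1..t+1}" "t + 1 - j \<in> {1..t+1}" "t \<in> {1..t+1}" "t + 1 \<in> {1..t+1}"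
    using assms(1,3) by auto
  then show ?thesis
    using assms(2) unfolding dual_coeff_def by (simp del: One_nat_def)
qed

lemma dual_coeff_1:
  assumes "1 \<le> t" and "\<forall>i\<in>{1..t+1}. g i \<noteq> 0"
  shows "dual_coeff t g 1 = 1"
  using assms unfolding dual_coeff_def by simp

text \<open>Both sides equal \<open>g (t + 1) * g t / g (t + 1 - i)\<close>, since in each the
  leading factor cancels against one factor of the denominator.\<close>

lemma dual_coeff_step:
  assumes "p < t" and "\<forall>i\<in>{1..t+1}. g i \<noteq> 0" and "i \<in> {1..p}"
  shows "g (t + 2 - i) * dual_coeff t g i = g (t - i) * dual_coeff t g (i + 1)"
proof -
  have "t + 2 - i \<in> {1..t+1}" "t - i \<in> {1..t+1}"
    using assms(1,3) by auto
  then have "g (t + 2 - i) \<noteq> 0" "g (t - i) \<noteq> 0"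
    using assms(2) by blast+
  then show ?thesis
    unfolding dual_coeff_def by simp
qed

text \<open>Each block row of the product is the difference of the two sides of
  \<open>dual_coeff_step\<close>, times the identity.\<close>

lemma bidiag_mult_dual_col:
  assumes "p < t" and "\<forall>i\<in>{1..t+1}. g i \<noteq> 0"
  shows "bidiag n p t g * dual_col n p t g = 0\<^sub>m (p * n) n"
proof -
  have "bidiag n p t g * dual_col n p t g = block_mat n p 1 (\<lambda>i j. 0\<^sub>m n n)"
    unfolding bidiag_def dual_col_def scalar_blocks_def[of n "p + 1"] scalar_blocks_mult_block_mat
  proof (rule block_mat_cong)
    fix i j r s assume i: "i \<in> {1..p}" and rs: "r < n" "s < n"
    let ?h = "\<lambda>l. (dual_coeff t g l \<cdot>\<^sub>m 1\<^sub>m n) $$ (r, s)"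
    show "mat n n (\<lambda>(r, s). \<Sum>l=1..p+1. (if l = i then g (t + 2 - i) else if l = i + 1 then - g (t - i) else 0) *
        (dual_coeff t g l \<cdot>\<^sub>m 1\<^sub>m n) $$ (r, s)) $$ (r, s) = 0\<^sub>m n n $$ (r, s)"
      using rs sum_bidiag_row[OF i, of g t ?h] dual_coeff_step[OF assms i]
      by (simp add: mult.assoc[symmetric] del: One_nat_def sum.cl_ivl_Suc add_2_eq_Suc')
  qed
  also have "\<dots> = 0\<^sub>m (p * n) n"
    by (rule eq_block_matI[symmetric]) (auto simp: block_index_less simp del: One_nat_def)
  finally show ?thesis .
qed

lemma block_entry_dual_col_mult:
  assumes "i \<in> {1..p+1}" and "v \<in> carrier_vec n"
  shows "block_entry n (dual_col n p t g *\<^sub>v v) i = dual_coeff t g i \<cdot>\<^sub>v v"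
proof (rule eq_vecI)
  fix r assume "r < dim_vec (dual_coeff t g i \<cdot>\<^sub>v v)"
  then show "block_entry n (dual_col n p t g *\<^sub>v v) i $ r = (dual_coeff t g i \<cdot>\<^sub>v v) $ r"
    unfolding dual_col_def using assms
    by (subst block_entry_mult_scalar_blocks_vec) (auto simp: block_entry_def)
qed (use assms in auto)

text \<open>Block row \<open>i\<close> of the equation expresses block \<open>i + 1\<close> of
  \<open>u\<close> through block \<open>i\<close>, because the superdiagonal value
  \<open>g (t - i)\<close> is nonzero. Hence the first block determines \<open>u\<close>, and the
  recurrence is the one satisfied by \<open>dual_coeff\<close>.\<close>

lemma bidiag_kernel:
  assumes "p < t" and g: "\<forall>i\<in>{1..t+1}. g i \<noteq> 0"
    and u: "u \<in> carrier_vec ((p + 1) * n)" and 0: "bidiag n p t g *\<^sub>v u = 0\<^sub>v (p * n)"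
  shows "u = dual_col n p t g *\<^sub>v block_entry n u 1"
proof (rule eq_vec_blocksI[OF u])
  show "dual_col n p t g *\<^sub>v block_entry n u 1 \<in> carrier_vec ((p + 1) * n)"
    by (rule mult_mat_vec_carrier) (rule dual_col_carrier, simp)
  have step: "g (t + 2 - i) * block_entry n u i $ r = g (t - i) * block_entry n u (i + 1) $ r"
    if i: "i \<in> {1..p}" and r: "r < n" for i r
  proof -
    have "g (t + 2 - i) * block_entry n u i $ r - g (t - i) * block_entry n u (i + 1) $ r
        = block_entry n (bidiag n p t g *\<^sub>v u) i $ r"
      unfolding bidiag_def block_entry_mult_scalar_blocks_vec[OF i r u]
      by (rule sum_bidiag_row[OF i, symmetric])
    also have "\<dots> = 0"
      using i r block_index_less[OF i r] by (simp add: 0 block_entry_def)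
    finally show ?thesis by simp
  qed
  have main: "i + 1 \<le> p + 1 \<Longrightarrow>
      block_entry n u (i + 1) = dual_coeff t g (i + 1) \<cdot>\<^sub>v block_entry n u 1" for i
  proof (induction i)
    case 0
    then show ?case using dual_coeff_1[of t g] assms(1) g by simp
  next
    case (Suc i)
    show ?case
    proof (rule eq_vecI)
      fix r assume "r < dim_vec (dual_coeff t g (Suc i + 1) \<cdot>\<^sub>v block_entry n u 1)"
      then have r: "r < n" by simp
      have i: "Suc i \<in> {1..p}" using Suc.prems by simp
      have nz: "g (t - Suc i) \<noteq> 0" using i assms(1) by (intro g[rule_format]) auto
      have "g (t - Suc i) * block_entry n u (Suc i + 1) $ r
          = g (t + 2 - Suc i) * dual_coeff t g (Suc i) * block_entry n u 1 $ r"
        using step[OF i r] Suc r by (simp add: mult.assoc)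
      also have "\<dots> = g (t - Suc i) * (dual_coeff t g (Suc i + 1) * block_entry n u 1 $ r)"
        unfolding dual_coeff_step[OF assms(1) g i] by simp
      finally show "block_entry n u (Suc i + 1) $ r
          = (dual_coeff t g (Suc i + 1) \<cdot>\<^sub>v block_entry n u 1) $ r"
        using nz r by simp
    qed simp
  qed
  fix i assume i: "i \<in> {1..p+1}"
  then show "block_entry n u i = block_entry n (dual_col n p t g *\<^sub>v block_entry n u 1) i"
    using main[of "i - 1"] by (simp add: block_entry_dual_col_mult)
qed

text \<open>The first \<open>p\<close> block rows of the transpose form a lower bidiagonal system
  whose diagonal values \<open>g (t + 2 - i)\<close> are nonzero, so forward substitution makes all
  blocks vanish.\<close>

lemma transpose_bidiag_kernel:
  assumes "p < t" and g: "\<forall>i\<in>{1..t+1}. g i \<noteq> (0::'a::field)"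
    and u: "u \<in> carrier_vec (p * n)"
    and 0: "transpose_mat (bidiag n p t g) *\<^sub>v u = 0\<^sub>v ((p + 1) * n)"
  shows "u = 0\<^sub>v (p * n)"
proof (rule eq_vec_blocksI[OF u])
  have main: "block_entry n u i $ r = 0" if "i \<in> {1..p}" "r < n" for i r
    using that
  proof (induction i rule: less_induct)
    case (less i)
    let ?a = "\<lambda>j. if i = j then g (t + 2 - j) else if i = j + 1 then - g (t - j) else 0"
    have i: "i \<in> {1..p+1}" using less.prems by simp
    have "0 = block_entry n (transpose_mat (bidiag n p t g) *\<^sub>v u) i $ r"
      using less.prems block_index_less[OF i less.prems(2)] by (simp add: 0 block_entry_def)
    also have "\<dots> = (\<Sum>j=1..p. ?a j * block_entry n u j $ r)"
      unfolding bidiag_def transpose_scalar_blocks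
        block_entry_mult_scalar_blocks_vec[OF i less.prems(2) u]
      by (rule sum.cong) auto
    \<comment> \<open>The subdiagonal term belongs to block \<open>i - 1\<close>, which is zero by
      the induction hypothesis.\<close>
    also have "\<dots> = (\<Sum>j=1..p. if j = i then g (t + 2 - i) * block_entry n u i $ r else 0)"
      using less by (intro sum.cong) auto
    also have "\<dots> = g (t + 2 - i) * block_entry n u i $ r"
      using less.prems by simp
    finally show ?case
      using g[rule_format, of "t + 2 - i"] less.prems assms(1) by simp linarith
  qed
  fix i assume "i \<in> {1..p}"
  with main show "block_entry n u i = block_entry n (0\<^sub>v (p * n)) i"
    using block_index_less[of i p _ n] by (intro eq_vecI) (auto simp: block_entry_def)
qed simp

section \<open>Kernel of a block Kronecker matrix and its compression to one block\<close>

text \<open>The two bidiagonal matrices have independent parameters and enter symmetrically, so the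
  same statement applies to the pencil and to its transpose, where \<open>K\<close> and
  \<open>H\<close> change places.\<close>

lemma block_kronecker_kernel:
  fixes g :: "nat \<Rightarrow> 'a::field"
  assumes pt: "p < t" and qu: "q < u"
    and gt: "\<forall>i\<in>{1..t+1}. g i \<noteq> 0" and gu: "\<forall>i\<in>{1..u+1}. g i \<noteq> 0"
    and K: "K = bidiag n p t g" and H: "H = bidiag n q u g"
    and M: "M \<in> carrier_mat ((q + 1) * n) ((p + 1) * n)"
    and A: "A \<in> carrier_mat ((q + 1) * n) (p * n)"
    and B: "B \<in> carrier_mat (q * n) ((p + 1) * n)"
    and z: "z \<in> carrier_vec ((p + 1) * n + q * n)" "z \<noteq> 0\<^sub>v ((p + 1) * n + q * n)"
    and Lz: "four_block_mat (M + A * K + transpose_mat H * B) (transpose_mat H) K (0\<^sub>m (p * n) (q * n)) *\<^sub>v z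
      = 0\<^sub>v ((q + 1) * n + p * n)"
  obtains v where "v \<in> carrier_vec n" and "v \<noteq> 0\<^sub>v n"
    and "(transpose_mat (dual_col n q u g) * M * dual_col n p t g) *\<^sub>v v = 0\<^sub>v n"
    and "\<forall>i\<in>{1..p+1}. block_entry n z i = dual_coeff t g i \<cdot>\<^sub>v v"
proof
  let ?b = "(p + 1) * n" and ?c = "(q + 1) * n"
  let ?C = "dual_col n p t g" and ?D = "dual_col n q u g"
  define z1 where "z1 = vec_first z ?b"
  define z2 where "z2 = vec_last z (q * n)"
  define v where "v = block_entry n z1 1"
  \<comment> \<open>This combination absorbs \<open>B\<close>: the terms
    \<open>transpose_mat H * B\<close> applied to \<open>z1\<close> and
    \<open>transpose_mat H\<close> applied to \<open>z2\<close> add up to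
    \<open>transpose_mat H *\<^sub>v y\<close>.\<close>
  define y where "y = B *\<^sub>v z1 + z2"
  note z1c = vec_first_carrier[of z ?b, folded z1_def]
  note z2c = vec_last_carrier[of z "q * n", folded z2_def]
  have zsplit: "z = z1 @\<^sub>v z2"
    using z(1) unfolding z1_def z2_def by simp
  have Kc: "K \<in> carrier_mat (p * n) ?b" and Hc: "H \<in> carrier_mat (q * n) ?c"
    unfolding K H by (rule bidiag_carrier)+
  have HT: "transpose_mat H \<in> carrier_mat ?c (q * n)" using Hc by simp
  have AK: "A * K \<in> carrier_mat ?c ?b" using A Kc by (rule mult_carrier_mat)
  have HB: "transpose_mat H * B \<in> carrier_mat ?c ?b" using HT B by (rule mult_carrier_mat)
  let ?U = "M + A * K + transpose_mat H * B"
  have Uc: "?U \<in> carrier_mat ?c ?b" using M AK HB by simp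
  have "(?U *\<^sub>v z1 + transpose_mat H *\<^sub>v z2) @\<^sub>v (K *\<^sub>v z1 + 0\<^sub>m (p * n) (q * n) *\<^sub>v z2) =
      0\<^sub>v ?c @\<^sub>v 0\<^sub>v (p * n)"
    using Lz unfolding zsplit
    by (subst (asm) four_block_mat_mult_vec[OF Uc HT Kc _ z1c z2c]) auto
  moreover have "?U *\<^sub>v z1 + transpose_mat H *\<^sub>v z2 \<in> carrier_vec ?c"
    by (intro add_carrier_vec mult_mat_vec_carrier[OF Uc z1c] mult_mat_vec_carrier[OF HT z2c])
  ultimately have top: "?U *\<^sub>v z1 + transpose_mat H *\<^sub>v z2 = 0\<^sub>v ?c"
    and bot0: "K *\<^sub>v z1 + 0\<^sub>m (p * n) (q * n) *\<^sub>v z2 = 0\<^sub>v (p * n)"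
    using append_vec_eq[of _ ?c "0\<^sub>v ?c"] by auto
  have bot: "K *\<^sub>v z1 = 0\<^sub>v (p * n)"
  proof -
    have "0\<^sub>m (p * n) (q * n) *\<^sub>v z2 = 0\<^sub>v (p * n)" using z2c by auto
    then show ?thesis using bot0 mult_mat_vec_carrier[OF Kc z1c] by simp
  qed
  have z1: "z1 = ?C *\<^sub>v v"
    using bidiag_kernel[OF pt gt z1c] bot unfolding K v_def by blast
  show vc: "v \<in> carrier_vec n" by (simp add: v_def)
  have yc: "y \<in> carrier_vec (q * n)"
    unfolding y_def using mult_mat_vec_carrier[OF B z1c] z2c by simp
  have "M *\<^sub>v z1 + transpose_mat H *\<^sub>v y = ?U *\<^sub>v z1 + transpose_mat H *\<^sub>v z2"
  proof -
    have Mz: "M *\<^sub>v z1 \<in> carrier_vec ?c" by (rule mult_mat_vec_carrier[OF M z1c])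
    have "?U *\<^sub>v z1 = M *\<^sub>v z1 + A *\<^sub>v (K *\<^sub>v z1) + transpose_mat H *\<^sub>v (B *\<^sub>v z1)"
      using add_mult_distrib_mat_vec[OF add_carrier_mat[OF AK, of M] HB z1c]
        add_mult_distrib_mat_vec[OF M AK z1c]
        assoc_mult_mat_vec[OF A Kc z1c] assoc_mult_mat_vec[OF HT B z1c] by simp
    \<comment> \<open>The contribution of \<open>A\<close> disappears because \<open>z1\<close> lies
      in the kernel of \<open>K\<close>.\<close>
    also have "A *\<^sub>v (K *\<^sub>v z1) = 0\<^sub>v ?c"
      unfolding bot using A by auto
    also have "M *\<^sub>v z1 + 0\<^sub>v ?c = M *\<^sub>v z1" using Mz by simp
    finally have U: "?U *\<^sub>v z1 = M *\<^sub>v z1 + transpose_mat H *\<^sub>v (B *\<^sub>v z1)" .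
    have Bz: "B *\<^sub>v z1 \<in> carrier_vec (q * n)" by (rule mult_mat_vec_carrier[OF B z1c])
    show ?thesis
      unfolding U y_def mult_add_distrib_mat_vec[OF HT Bz z2c]
      using assoc_add_vec[OF Mz mult_mat_vec_carrier[OF HT Bz] mult_mat_vec_carrier[OF HT z2c]]
      by simp
  qed
  with top have My: "M *\<^sub>v z1 + transpose_mat H *\<^sub>v y = 0\<^sub>v ?c" by simp
  have Cc: "?C \<in> carrier_mat ?b n" and Dc: "?D \<in> carrier_mat ?c n" by (rule dual_col_carrier)+
  have DT: "transpose_mat ?D \<in> carrier_mat n ?c" using Dc by simp
  \<comment> \<open>This is the transpose of \<open>H * ?D = 0\<close>; multiplying from the left by
    the transposed dual column therefore eliminates \<open>y\<close>.\<close>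
  have DH: "transpose_mat ?D * transpose_mat H = 0\<^sub>m n (q * n)"
    using transpose_mult[OF Hc Dc] bidiag_mult_dual_col[OF qu gu, where n = n] unfolding H by simp
  have Mz: "M *\<^sub>v z1 \<in> carrier_vec ?c" by (rule mult_mat_vec_carrier[OF M z1c])
  have Hy: "transpose_mat H *\<^sub>v y \<in> carrier_vec ?c" by (rule mult_mat_vec_carrier[OF HT yc])
  have "0\<^sub>v n = transpose_mat ?D *\<^sub>v (M *\<^sub>v z1 + transpose_mat H *\<^sub>v y)"
    unfolding My using DT by auto
  also have "\<dots> = transpose_mat ?D *\<^sub>v (M *\<^sub>v z1) + (transpose_mat ?D * transpose_mat H) *\<^sub>v y"
    by (simp add: mult_add_distrib_mat_vec[OF DT Mz Hy] assoc_mult_mat_vec[OF DT HT yc])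
  also have "\<dots> = transpose_mat ?D *\<^sub>v (M *\<^sub>v z1)"
  proof -
    have "0\<^sub>m n (q * n) *\<^sub>v y = 0\<^sub>v n" using yc by auto
    then show ?thesis unfolding DH using mult_mat_vec_carrier[OF DT Mz] by simp
  qed
  also have "\<dots> = (transpose_mat ?D * M) *\<^sub>v z1"
    by (rule assoc_mult_mat_vec[OF DT M z1c, symmetric])
  also have "\<dots> = (transpose_mat ?D * M * ?C) *\<^sub>v v"
    unfolding z1 by (rule assoc_mult_mat_vec[OF mult_carrier_mat[OF DT M] Cc vc, symmetric])
  finally show "(transpose_mat ?D * M * ?C) *\<^sub>v v = 0\<^sub>v n" ..
  show "\<forall>i\<in>{1..p+1}. block_entry n z i = dual_coeff t g i \<cdot>\<^sub>v v"
  proof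
    fix i assume i: "i \<in> {1..p+1}"
    have "block_entry n z i = block_entry n z1 i"
    proof (rule eq_vecI)
      fix r assume "r < dim_vec (block_entry n z1 i)"
      then have "r < n" and "(i - 1) * n + r < ?b"
        using block_index_less[OF i] by auto
      then show "block_entry n z i $ r = block_entry n z1 i $ r"
        using z1c z2c unfolding zsplit block_entry_def by (simp del: mult_Suc One_nat_def)
    qed simp
    then show "block_entry n z i = dual_coeff t g i \<cdot>\<^sub>v v"
      unfolding z1 block_entry_dual_col_mult[OF i vc] .
  qed
  show "v \<noteq> 0\<^sub>v n"
  proof
    assume "v = 0\<^sub>v n"
    then have z10: "z1 = 0\<^sub>v ?b" unfolding z1 using Cc by auto
    have "B *\<^sub>v z1 = 0\<^sub>v (q * n)" unfolding z10 using B by auto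
    then have "y = z2" unfolding y_def using z2c by simp
    moreover have "M *\<^sub>v z1 = 0\<^sub>v ?c" unfolding z10 using M by auto
    ultimately have "transpose_mat H *\<^sub>v z2 = 0\<^sub>v ?c" using My Hy by simp
    then have "z2 = 0\<^sub>v (q * n)"
      using transpose_bidiag_kernel[OF qu gu z2c] unfolding H by blast
    then have "z = 0\<^sub>v (?b + q * n)" unfolding zsplit z10 by auto
    with z(2) show False by simp
  qed
qed

text \<open>Both dual columns consist of a single block column of multiples of the identity, so the
  product is one \<open>n \<times> n\<close> block, a weighted sum of all blocks of the middle
  factor.\<close>

lemma dual_sandwich:
  assumes rs: "r < n" "s < n"
  shows "(transpose_mat (dual_col n q u g) * block_mat n (q + 1) (p + 1) F * dual_col n p t g) $$ (r, s) =
    (\<Sum>i=1..q+1. \<Sum>j=1..p+1. dual_coeff u g i * F i j $$ (r, s) * dual_coeff t g j)"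
proof -
  let ?G = "\<lambda>i j. mat n n (\<lambda>(r, s). \<Sum>l=1..q+1. dual_coeff u g l * F l j $$ (r, s))"
  let ?S = "\<lambda>i j. mat n n (\<lambda>(r, s). \<Sum>l=1..p+1. ?G i l $$ (r, s) * dual_coeff t g l)"
  have eq: "transpose_mat (dual_col n q u g) * block_mat n (q + 1) (p + 1) F * dual_col n p t g
      = block_mat n 1 1 ?S"
    unfolding dual_col_def transpose_scalar_blocks scalar_blocks_mult_block_mat
      block_mat_mult_scalar_blocks ..
  have "block_mat n 1 1 ?S $$ (r, s) = ?S 1 1 $$ (r, s)"
    by (rule block_mat_1_1_index[OF rs])
  also have "\<dots> = (\<Sum>j=1..p+1. \<Sum>i=1..q+1. dual_coeff u g i * F i j $$ (r, s) * dual_coeff t g j)"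
    using rs by (simp only: index_mat(1) prod.case sum_distrib_right)
  finally show ?thesis unfolding eq by (subst sum.swap)
qed

section \<open>Values of the pencil at finite points and at infinity\<close>

text \<open>
  At infinity, evaluating the grade \<open>d\<close> reversal at \<open>0\<close> amounts to taking the coefficient of index \<open>d\<close>.
\<close>

fun point_value :: "nat \<Rightarrow> ext_complex \<Rightarrow> complex poly \<Rightarrow> complex" where
  "point_value d (Finite a) p = poly p a"
| "point_value d Infinite p = coeff p d"

lemma point_value_linear [simp]:
  "point_value d lam 0 = 0"
  "point_value d lam (- p) = - point_value d lam p"
  "point_value d lam (p + q) = point_value d lam p + point_value d lam q"
  "point_value d lam (smult c p) = c * point_value d lam p"
  "point_value d lam (sum h S) = (\<Sum>i\<in>S. point_value d lam (h i))"
  by (cases lam; simp add: poly_sum coeff_sum)+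

text \<open>At \<open>0\<close> only the constant term of the reversal survives, which is the
  coefficient of index \<open>d\<close>. Both kinds of points thus become a linear functional
  applied entrywise, and one argument serves for both.\<close>

lemma value_mp_eq_map_mat: "value_mp d Q lam = map_mat (point_value d lam) Q"
proof (cases lam)
  case (Finite a)
  then show ?thesis by (auto simp: eval_mp_def intro!: eq_matI)
next
  case Infinite
  have "poly (rev_grade d p) 0 = coeff p d" for p
  proof -
    have "poly (rev_grade d p) 0 = (\<Sum>i\<le>d. if i = d then coeff p i else 0)"
      unfolding rev_grade_def poly_sum poly_monom by (intro sum.cong) auto
    then show ?thesis by simp
  qed
  then show ?thesis
    unfolding Infinite by (auto simp: eval_mp_def rev_mp_def)
qed

lemma map_block_mat:
  assumes "\<And>i j. \<lbrakk>i \<in> {1..p}; j \<in> {1..q}\<rbrakk> \<Longrightarrow> F i j \<in> carrier_mat n n"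
  shows "map_mat f (block_mat n p q F) = block_mat n p q (\<lambda>i j. map_mat f (F i j))"
proof (rule eq_block_matI)
  fix i r j s assume ij: "i \<in> {1..p}" "r < n" "j \<in> {1..q}" "s < n"
  with block_index_less[OF ij(1,2)] block_index_less[OF ij(3,4)] assms[OF ij(1,3)]
  show "map_mat f (block_mat n p q F) $$ ((i - 1) * n + r, (j - 1) * n + s) = map_mat f (F i j) $$ (r, s)"
    using block_mat_index[OF ij, of F] by (simp del: One_nat_def)
qed simp

lemma map_point_value_add:
  assumes "Q \<in> carrier_mat nr nc" and "R \<in> carrier_mat nr nc"
  shows "map_mat (point_value d lam) (Q + R) = map_mat (point_value d lam) Q + map_mat (point_value d lam) R"
  using assms by (intro eq_matI) auto

text \<open>Taking a fixed coefficient is not multiplicative, but it is linear over constants. This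
  suffices for the pencil, in which \<open>A\<close> and \<open>B\<close> are constant
  matrices.\<close>

lemma map_point_value_const_mult:
  assumes "dim_col A = dim_row Q"
  shows "map_mat (point_value d lam) (const_mp A * Q) = A * map_mat (point_value d lam) Q"
  using assms by (intro eq_matI) (auto simp: const_mp_def scalar_prod_def intro!: sum.cong)

lemma map_point_value_mult_const:
  assumes "dim_col Q = dim_row A"
  shows "map_mat (point_value d lam) (Q * const_mp A) = map_mat (point_value d lam) Q * A"
  using assms by (intro eq_matI) (auto simp: const_mp_def scalar_prod_def mult.commute intro!: sum.cong)

lemma transpose_map_mat: "transpose_mat (map_mat f Q) = map_mat f (transpose_mat Q)"
  by (rule eq_matI) auto

lemma map_K1Lag:
  assumes "\<mu> < k"
  shows "map_mat (point_value 1 lam) (K1Lag n k \<mu> x) =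
    bidiag n (k - \<mu> - 1) k (\<lambda>i. point_value 1 lam (gam x i))"
proof -
  have "k - \<mu> - 1 + 1 = k - \<mu>" using assms by simp
  then show ?thesis
    unfolding K1Lag_def bidiag_def scalar_blocks_def
    by (subst map_block_mat) (auto intro!: block_mat_cong)
qed

lemma map_K2Lag:
  "map_mat (point_value 1 lam) (K2Lag n \<mu> x) =
    bidiag n \<mu> (\<mu> + 1) (\<lambda>i. point_value 1 lam (gam x i))"
  unfolding K2Lag_def bidiag_def scalar_blocks_def
  by (subst map_block_mat) (auto intro!: block_mat_cong simp: numeral_3_eq_3)

text \<open>The entries are written through scalar functions \<open>g\<close> and \<open>t\<close>,
  so that after sandwiching they become the summands of
  \<open>sum_dual_coeff_blocks\<close>.\<close>

lemma map_MLag: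
  assumes "\<mu> < k" and "\<forall>i\<in>{1..k+1}. Pc i \<in> carrier_mat n n"
  shows "map_mat (point_value 1 lam) (MLag n k \<mu> x Pc) = block_mat n (\<mu> + 1) (k - \<mu>) (\<lambda>i j. mat n n (\<lambda>(r, s).
    let g = \<lambda>i. point_value 1 lam (gam x i); t = \<lambda>i. bary_weight x k i * Pc i $$ (r, s) in
     if i = 1 \<and> j = 1 then g k * t (k + 1) + g (k + 1) * t k
     else if i = 1 then g (k + 2 - j) * t (k + 1 - j)
     else if j = k - \<mu> then g (\<mu> + 3 - i) * t (\<mu> + 2 - i)
     else 0))"
proof -
  have Pwg: "Pwg k x Pc i j \<in> carrier_mat n n"
    "\<And>r s. \<lbrakk>r < n; s < n\<rbrakk> \<Longrightarrow> point_value 1 lam (Pwg k x Pc i j $$ (r, s)) =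
      point_value 1 lam (gam x j) * (bary_weight x k i * Pc i $$ (r, s))"
    if "i \<in> {1..k+1}" for i j
    using bspec[OF assms(2) that] by (auto simp: Pwg_def const_mp_def)
  \<comment> \<open>All coefficient indices that occur lie in \<open>{1..k+1}\<close>, where the
    coefficients are known to be \<open>n \<times> n\<close>; \<open>\<mu> < k\<close> also ensures
    \<open>k \<ge> 1\<close>.\<close>
  have idx: "k + 1 \<in> {1..k+1}" "k \<in> {1..k+1}"
    "\<And>j. j \<in> {1..k-\<mu>} \<Longrightarrow> k + 1 - j \<in> {1..k+1}"
    "\<And>i. i \<in> {1..\<mu>+1} \<Longrightarrow> \<mu> + 2 - i \<in> {1..k+1}"
    using assms(1) by auto
  show ?thesis
    unfolding MLag_def
  proof (subst map_block_mat)
    fix i j assume "i \<in> {1..\<mu>+1}" "j \<in> {1..k-\<mu>}"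
    then show "(if i = 1 \<and> j = 1 then Pwg k x Pc (k + 1) k + Pwg k x Pc k (k + 1)
     else if i = 1 then Pwg k x Pc (k + 1 - j) (k + 2 - j)
     else if j = k - \<mu> then Pwg k x Pc (\<mu> + 2 - i) (\<mu> + 3 - i)
     else 0\<^sub>m n n) \<in> carrier_mat n n"
      using assms(1) by (auto intro!: Pwg(1) add_carrier_mat)
  next
    show "block_mat n (\<mu> + 1) (k - \<mu>) (\<lambda>i j. map_mat (point_value 1 lam)
      (if i = 1 \<and> j = 1 then Pwg k x Pc (k + 1) k + Pwg k x Pc k (k + 1)
       else if i = 1 then Pwg k x Pc (k + 1 - j) (k + 2 - j)
       else if j = k - \<mu> then Pwg k x Pc (\<mu> + 2 - i) (\<mu> + 3 - i)
       else 0\<^sub>m n n)) = block_mat n (\<mu> + 1) (k - \<mu>) (\<lambda>i j. mat n n (\<lambda>(r, s).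
    let g = \<lambda>i. point_value 1 lam (gam x i); t = \<lambda>i. bary_weight x k i * Pc i $$ (r, s) in
     if i = 1 \<and> j = 1 then g k * t (k + 1) + g (k + 1) * t k
     else if i = 1 then g (k + 2 - j) * t (k + 1 - j)
     else if j = k - \<mu> then g (\<mu> + 3 - i) * t (\<mu> + 2 - i)
     else 0))"
    proof (rule block_mat_cong, goal_cases)
      case (1 i j r s)
      note c = Pwg(1)[OF idx(1), of k] Pwg(1)[OF idx(2), of "k + 1"]
        Pwg(1)[OF idx(3), of j "k + 2 - j"] Pwg(1)[OF idx(4), of i "\<mu> + 3 - i"]
      note v = Pwg(2)[OF idx(1), of r s k] Pwg(2)[OF idx(2), of r s "k + 1"]
        Pwg(2)[OF idx(3), of j r s "k + 2 - j"] Pwg(2)[OF idx(4), of i r s "\<mu> + 3 - i"]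
      show ?case
        using 1 c v by (simp add: Let_def carrier_matD del: One_nat_def add_2_eq_Suc')
    qed
  qed
qed

section \<open>The compressed pencil as a barycentric sum\<close>

text \<open>Each nonzero block, weighted by its two dual coefficients, yields the common factor
  times \<open>t i / g i\<close> for one node; the corner block yields two. The first block row
  accounts for the nodes \<open>k + 1, k, \<dots>, \<mu> + 1\<close> and the rest of the last block
  column for \<open>\<mu>, \<dots>, 1\<close>, so every node occurs exactly once.\<close>

lemma sum_dual_coeff_blocks:
  fixes g t :: "nat \<Rightarrow> 'a::field"
  assumes mu: "\<mu> < k" and g: "\<forall>i\<in>{1..k+1}. g i \<noteq> 0"
  shows "(\<Sum>i=1..\<mu>+1. \<Sum>j=1..k-\<mu>. dual_coeff (\<mu> + 1) g i *
     (if i = 1 \<and> j = 1 then g k * t (k + 1) + g (k + 1) * t k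
     else if i = 1 then g (k + 2 - j) * t (k + 1 - j)
     else if j = k - \<mu> then g (\<mu> + 3 - i) * t (\<mu> + 2 - i)
     else 0) * dual_coeff k g j) = g (k + 1) * g k * (\<Sum>i=1..k+1. t i / g i)"
    (is "(\<Sum>i=1..\<mu>+1. \<Sum>j=1..k-\<mu>. ?d i * ?m i j * ?c j) = ?G * _")
proof -
  define h where "h i = t i / g i" for i
  have d1: "?d 1 = 1" using dual_coeff_1[of "\<mu> + 1" g] g mu by simp
  have c1: "?c 1 = 1" using dual_coeff_1[of k g] g mu by simp
  have row1: "(\<Sum>j=1..k-\<mu>. ?d 1 * ?m 1 j * ?c j) = ?G * (h (k + 1) + (\<Sum>i=\<mu>+1..k. h i))"
  proof -
    \<comment> \<open>The indicator records the additional node \<open>k + 1\<close> contributed by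
      the two-term corner block.\<close>
    have "?d 1 * ?m 1 j * ?c j = ?G * ((if j = 1 then h (k + 1) else 0) + h (k + 1 - j))"
      if j: "j \<in> {1..k-\<mu>}" for j
    proof (cases "j = 1")
      case True
      have "g (k + 1) \<noteq> 0" "g k \<noteq> 0" using g mu by auto
      with True show ?thesis
        using d1 c1 by (simp add: h_def field_simps)
    next
      case False
      have "k + 2 - j \<in> {1..k+1}" "k + 1 - j \<in> {1..k+1}"
        using j by auto
      then have "g (k + 2 - j) \<noteq> 0" "g (k + 1 - j) \<noteq> 0" using g by blast+
      with False d1 show ?thesis
        unfolding dual_coeff_def[of k] h_def
        by (simp add: field_simps del: One_nat_def add_2_eq_Suc')
    qed
    then have "(\<Sum>j=1..k-\<mu>. ?d 1 * ?m 1 j * ?c j) =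
        (\<Sum>j=1..k-\<mu>. ?G * ((if j = 1 then h (k + 1) else 0) + h (k + 1 - j)))"
      by (rule sum.cong[OF refl])
    also have "\<dots> = ?G * ((\<Sum>j=1..k-\<mu>. if j = 1 then h (k + 1) else 0) + (\<Sum>j=1..k-\<mu>. h (k + 1 - j)))"
      by (simp only: sum_distrib_left[symmetric] sum.distrib)
    also have "(\<Sum>j=1..k-\<mu>. if j = 1 then h (k + 1) else 0) = h (k + 1)"
      using mu by simp
    also have "(\<Sum>j=1..k-\<mu>. h (k + 1 - j)) = (\<Sum>i=\<mu>+1..k. h i)"
      by (rule sum.reindex_bij_witness[of _ "\<lambda>i. k + 1 - i" "\<lambda>i. k + 1 - i"]) auto
    finally show ?thesis .
  qed
  have rows: "(\<Sum>j=1..k-\<mu>. ?d i * ?m i j * ?c j) = ?G * h (\<mu> + 2 - i)"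
    if i: "i \<in> {2..\<mu>+1}" for i
  proof -
    have "(\<Sum>j=1..k-\<mu>. ?d i * ?m i j * ?c j) = (\<Sum>j\<in>{k - \<mu>}. ?d i * ?m i j * ?c j)"
      using i mu by (intro sum.mono_neutral_right) auto
    also have "\<dots> = ?d i * (g (\<mu> + 3 - i) * t (\<mu> + 2 - i)) * ?c (k - \<mu>)"
      using i by simp
    \<comment> \<open>The numerator of \<open>?d i\<close> is
      \<open>g (\<mu> + 2) * g (\<mu> + 1)\<close>, which is exactly the denominator of
      \<open>?c (k - \<mu>)\<close>. After this cancellation \<open>g (\<mu> + 3 - i)\<close>
      cancels as well.\<close>
    also have "\<dots> = ?G * h (\<mu> + 2 - i)"
    proof -
      have "\<mu> + 3 - i \<in> {1..k+1}" "\<mu> + 2 - i \<in> {1..k+1}" "\<mu> + 2 \<in> {1..k+1}" "\<mu> + 1 \<in> {1..k+1}"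
        using i mu by auto
      then have nz: "g (\<mu> + 3 - i) \<noteq> 0" "g (\<mu> + 2 - i) \<noteq> 0" "g (\<mu> + 2) \<noteq> 0" "g (\<mu> + 1) \<noteq> 0"
        using g by blast+
      have "?d i = g (\<mu> + 2) * g (\<mu> + 1) / (g (\<mu> + 3 - i) * g (\<mu> + 2 - i))"
        unfolding dual_coeff_def by (simp add: numeral_3_eq_3)
      moreover have "?c (k - \<mu>) = ?G / (g (\<mu> + 2) * g (\<mu> + 1))"
      proof -
        have "k + 2 - (k - \<mu>) = \<mu> + 2" "k + 1 - (k - \<mu>) = \<mu> + 1" using mu by auto
        then show ?thesis unfolding dual_coeff_def by simp
      qed
      ultimately show ?thesis
        using nz unfolding h_def by (simp add: field_simps del: One_nat_def add_2_eq_Suc')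
    qed
    finally show ?thesis .
  qed
  have "(\<Sum>i=1..\<mu>+1. \<Sum>j=1..k-\<mu>. ?d i * ?m i j * ?c j) =
      ?G * (h (k + 1) + (\<Sum>i=\<mu>+1..k. h i)) + (\<Sum>i=2..\<mu>+1. ?G * h (\<mu> + 2 - i))"
  proof -
    have "{1..\<mu>+1} = insert 1 {2..\<mu>+1}" by auto
    then have "(\<Sum>i=1..\<mu>+1. \<Sum>j=1..k-\<mu>. ?d i * ?m i j * ?c j) =
        (\<Sum>j=1..k-\<mu>. ?d 1 * ?m 1 j * ?c j) + (\<Sum>i=2..\<mu>+1. \<Sum>j=1..k-\<mu>. ?d i * ?m i j * ?c j)"
      by (subst \<open>{1..\<mu>+1} = insert 1 {2..\<mu>+1}\<close>, subst sum.insert) auto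
    with row1 rows show ?thesis by simp
  qed
  also have "(\<Sum>i=2..\<mu>+1. ?G * h (\<mu> + 2 - i)) = ?G * (\<Sum>i=1..\<mu>. h i)"
    unfolding sum_distrib_left
    by (rule sum.reindex_bij_witness[of _ "\<lambda>i. \<mu> + 2 - i" "\<lambda>i. \<mu> + 2 - i"]) auto
  also have "?G * (h (k + 1) + (\<Sum>i=\<mu>+1..k. h i)) + ?G * (\<Sum>i=1..\<mu>. h i) = ?G * (\<Sum>i=1..k+1. h i)"
  proof -
    have "(\<Sum>i=1..k. h i) = (\<Sum>i=1..\<mu>. h i) + (\<Sum>i=\<mu>+1..k. h i)"
      using mu sum.ub_add_nat[of 1 \<mu> h "k - \<mu>"] by simp
    then show ?thesis by (simp add: algebra_simps)
  qed
  finally show ?thesis unfolding h_def .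
qed

section \<open>The Lagrange polynomial away from the nodes\<close>

text \<open>The condition holds vacuously at infinity, so a single hypothesis covers both items of
  the theorem.\<close>

definition off_nodes :: "(nat \<Rightarrow> complex) \<Rightarrow> nat \<Rightarrow> ext_complex \<Rightarrow> bool" where
  "off_nodes x k lam \<longleftrightarrow> (\<forall>a. lam = Finite a \<longrightarrow> a \<notin> x ` {1..k+1})"

lemma point_value_gam_nonzero:
  assumes "off_nodes x k lam" and "i \<in> {1..k+1}"
  shows "point_value 1 lam (gam x i) \<noteq> 0"
  using assms by (cases lam) (auto simp: off_nodes_def gam_def)

text \<open>At a finite point the factor \<open>c\<close> is the value of \<open>ell x k\<close>,
  nonzero off the nodes. At infinity it is \<open>1\<close>: the linear factors have value
  \<open>1\<close> there, and each quotient of \<open>ell x k\<close> by one of them is monic of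
  degree \<open>k\<close>.\<close>

lemma value_lagrange_mp:
  assumes "off_nodes x k lam"
  obtains c where "c \<noteq> 0" and "\<forall>r<n. \<forall>s<n. value_mp k (lagrange_mp n k x Pc) lam $$ (r, s) =
    c * (\<Sum>i=1..k+1. bary_weight x k i * Pc i $$ (r, s) / point_value 1 lam (gam x i))"
proof (cases lam)
  case (Finite a)
  have a: "a \<notin> x ` {1..k+1}" using assms Finite by (simp add: off_nodes_def)
  have "value_mp k (lagrange_mp n k x Pc) lam $$ (r, s) = poly (ell x k) a *
      (\<Sum>i=1..k+1. bary_weight x k i * Pc i $$ (r, s) / point_value 1 lam (gam x i))"
    if rs: "r < n" "s < n" for r s
  proof -
    have "value_mp k (lagrange_mp n k x Pc) lam $$ (r, s) = poly (lagrange_mp n k x Pc $$ (r, s)) a"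
      using rs by (simp add: Finite eval_mp_def lagrange_mp_def)
    also have "\<dots> = poly (ell x k) a *
        (\<Sum>i=1..k+1. Pc i $$ (r, s) * bary_weight x k i / poly (gam x i) a)"
      by (rule poly_lagrange_mp[OF rs a])
    finally show ?thesis
      unfolding Finite point_value.simps by (simp add: mult.commute)
  qed
  moreover have "poly (ell x k) a \<noteq> 0"
    using a by (auto simp: ell_def poly_prod gam_def)
  ultimately show ?thesis
    using that by blast
next
  case Infinite
  have monic: "coeff (ell x k div gam x i) k = 1" if i: "i \<in> {1..k+1}" for i
  proof -
    have "degree (\<Prod>j\<in>{1..k+1} - {i}. gam x j) = k"
      using i by (subst degree_prod_eq_sum_degree) (auto simp: gam_def)
    moreover have "lead_coeff (\<Prod>j\<in>{1..k+1} - {i}. gam x j) = 1"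
      unfolding lead_coeff_prod by (simp add: gam_def)
    ultimately show ?thesis unfolding ell_div_gam[OF i] by simp
  qed
  have "value_mp k (lagrange_mp n k x Pc) lam $$ (r, s) =
      1 * (\<Sum>i=1..k+1. bary_weight x k i * Pc i $$ (r, s) / point_value 1 lam (gam x i))"
    if rs: "r < n" "s < n" for r s
  proof -
    have "value_mp k (lagrange_mp n k x Pc) lam $$ (r, s) =
        (\<Sum>i=1..k+1. Pc i $$ (r, s) * bary_weight x k i * coeff (ell x k div gam x i) k)"
      using rs unfolding value_mp_eq_map_mat Infinite
      by (simp add: lagrange_mp_def coeff_sum del: sum.cl_ivl_Suc)
    also have "\<dots> = (\<Sum>i=1..k+1. Pc i $$ (r, s) * bary_weight x k i)"
      using monic by (intro sum.cong) auto
    finally show ?thesis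
      unfolding Infinite by (simp add: gam_def mult.commute del: sum.cl_ivl_Suc)
  qed
  then show ?thesis
    using that[of 1] one_neq_zero by blast
qed

text \<open>Entry by entry, both matrices are multiples of the same barycentric sum. The multiple on
  the sandwich side, \<open>g (k + 1) * g k\<close>, is nonzero and can be divided out, so kernel
  vectors of the sandwich are kernel vectors of the value of the Lagrange polynomial.\<close>

lemma value_lagrange_eq_sandwich:
  assumes mu: "\<mu> < k" and Pc: "\<forall>i\<in>{1..k+1}. Pc i \<in> carrier_mat n n"
    and off: "off_nodes x k lam"
  defines "g \<equiv> \<lambda>i. point_value 1 lam (gam x i)"
  obtains c where "value_mp k (lagrange_mp n k x Pc) lam = c \<cdot>\<^sub>m
    (transpose_mat (dual_col n \<mu> (\<mu> + 1) g) * map_mat (point_value 1 lam) (MLag n k \<mu> x Pc) *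
      dual_col n (k - \<mu> - 1) k g)"
proof -
  let ?S = "transpose_mat (dual_col n \<mu> (\<mu> + 1) g) * map_mat (point_value 1 lam) (MLag n k \<mu> x Pc) *
      dual_col n (k - \<mu> - 1) k g"
  let ?V = "value_mp k (lagrange_mp n k x Pc) lam"
  obtain c where c: "\<forall>r<n. \<forall>s<n. ?V $$ (r, s) =
      c * (\<Sum>i=1..k+1. bary_weight x k i * Pc i $$ (r, s) / g i)"
    unfolding g_def by (rule value_lagrange_mp[OF off])
  have g: "\<forall>i\<in>{1..k+1}. g i \<noteq> 0"
    using point_value_gam_nonzero[OF off] unfolding g_def by blast
  \<comment> \<open>With truncated subtraction this relies on \<open>\<mu> < k\<close>; it matches
    the \<open>k - \<mu>\<close> block columns with the \<open>p + 1\<close> of the bidiagonal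
    lemmas.\<close>
  have p: "k - \<mu> - 1 + 1 = k - \<mu>" using mu by simp
  have dims: "dim_row ?S = n" "dim_col ?S = n"
    using dual_col_carrier[of n \<mu> "\<mu> + 1" g] dual_col_carrier[of n "k - \<mu> - 1" k g]
    by (simp_all del: dual_col_carrier)
  define F where "F = (\<lambda>i j. mat n n (\<lambda>(r, s).
     if i = 1 \<and> j = 1 then g k * (bary_weight x k (k + 1) * Pc (k + 1) $$ (r, s))
       + g (k + 1) * (bary_weight x k k * Pc k $$ (r, s))
     else if i = 1 then g (k + 2 - j) * (bary_weight x k (k + 1 - j) * Pc (k + 1 - j) $$ (r, s))
     else if j = k - \<mu> then g (\<mu> + 3 - i) * (bary_weight x k (\<mu> + 2 - i) * Pc (\<mu> + 2 - i) $$ (r, s))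
     else 0))"
  have M: "map_mat (point_value 1 lam) (MLag n k \<mu> x Pc) = block_mat n (\<mu> + 1) (k - \<mu>) F"
    unfolding map_MLag[OF mu Pc] F_def g_def Let_def ..
  have S: "?S $$ (r, s) = g (k + 1) * g k * (\<Sum>i=1..k+1. bary_weight x k i * Pc i $$ (r, s) / g i)"
    if rs: "r < n" "s < n" for r s
    unfolding M dual_sandwich[OF rs, of \<mu> "\<mu> + 1" g "k - \<mu> - 1", unfolded p]
      sum_dual_coeff_blocks[OF mu g, symmetric]
    using rs by (intro sum.cong refl arg_cong2[of _ _ _ _ "(*)"]) (simp only: F_def index_mat(1) prod.case)
  have nz: "g (k + 1) * g k \<noteq> 0" using g mu by simp
  show ?thesis
  proof
    show "?V = (c / (g (k + 1) * g k)) \<cdot>\<^sub>m ?S"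
    proof (rule eq_matI)
      fix r s assume "r < dim_row ((c / (g (k + 1) * g k)) \<cdot>\<^sub>m ?S)" "s < dim_col ((c / (g (k + 1) * g k)) \<cdot>\<^sub>m ?S)"
      then have rs: "r < n" "s < n" using dims by auto
      then have "((c / (g (k + 1) * g k)) \<cdot>\<^sub>m ?S) $$ (r, s) = c / (g (k + 1) * g k) * ?S $$ (r, s)"
        using dims by (intro index_smult_mat) auto
      then show "?V $$ (r, s) = ((c / (g (k + 1) * g k)) \<cdot>\<^sub>m ?S) $$ (r, s)"
        using nz unfolding c[rule_format, OF rs] S[OF rs] by simp
    qed (use dims in \<open>auto simp: value_mp_eq_map_mat lagrange_mp_def\<close>)
  qed
qed

text \<open>Every product inside the pencil has a constant factor, so linearity carries the
  evaluation to each block and produces the form treated in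
  \<open>block_kronecker_kernel\<close>.\<close>

lemma value_lagrange_pencil:
  fixes x :: "nat \<Rightarrow> complex" and lam :: ext_complex
  assumes mu: "\<mu> < k"
    and A: "A \<in> carrier_mat ((\<mu> + 1) * n) ((k - \<mu> - 1) * n)"
    and B: "B \<in> carrier_mat (\<mu> * n) ((k - \<mu>) * n)"
  defines "g \<equiv> \<lambda>i. point_value 1 lam (gam x i)"
  shows "value_mp 1 (lagrange_pencil n k \<mu> x Pc A B) lam = four_block_mat
    (map_mat (point_value 1 lam) (MLag n k \<mu> x Pc) + A * bidiag n (k - \<mu> - 1) k g
      + transpose_mat (bidiag n \<mu> (\<mu> + 1) g) * B)
    (transpose_mat (bidiag n \<mu> (\<mu> + 1) g)) (bidiag n (k - \<mu> - 1) k g)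
    (0\<^sub>m ((k - \<mu> - 1) * n) (\<mu> * n))"
proof -
  let ?f = "map_mat (point_value 1 lam)"
  let ?M = "MLag n k \<mu> x Pc" and ?K = "K1Lag n k \<mu> x" and ?H = "K2Lag n \<mu> x"
  have M: "?M \<in> carrier_mat ((\<mu> + 1) * n) ((k - \<mu>) * n)"
    unfolding MLag_def by (rule block_mat_carrier)
  have K: "?K \<in> carrier_mat ((k - \<mu> - 1) * n) ((k - \<mu>) * n)"
    unfolding K1Lag_def by (rule block_mat_carrier)
  have H: "?H \<in> carrier_mat (\<mu> * n) ((\<mu> + 1) * n)"
    unfolding K2Lag_def by (rule block_mat_carrier)
  have HT: "transpose_mat ?H \<in> carrier_mat ((\<mu> + 1) * n) (\<mu> * n)" using H by simp
  have cA: "const_mp A \<in> carrier_mat ((\<mu> + 1) * n) ((k - \<mu> - 1) * n)"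
    and cB: "const_mp B \<in> carrier_mat (\<mu> * n) ((k - \<mu>) * n)"
    using A B by (simp_all add: const_mp_def)
  note AK = mult_carrier_mat[OF cA K] and HB = mult_carrier_mat[OF HT cB]
  have "?f (?M + const_mp A * ?K + transpose_mat ?H * const_mp B) =
      ?f ?M + ?f (const_mp A * ?K) + ?f (transpose_mat ?H * const_mp B)"
    unfolding map_point_value_add[OF add_carrier_mat[OF AK] HB] map_point_value_add[OF M AK] ..
  also have "?f (const_mp A * ?K) = A * ?f ?K"
    using A K by (intro map_point_value_const_mult) auto
  also have "?f (transpose_mat ?H * const_mp B) = transpose_mat (?f ?H) * B"
    unfolding transpose_map_mat using B HT by (intro map_point_value_mult_const) auto
  finally have top: "?f (?M + const_mp A * ?K + transpose_mat ?H * const_mp B) =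
      ?f ?M + A * ?f ?K + transpose_mat (?f ?H) * B" .
  have zero: "?f (0\<^sub>m ((k - \<mu> - 1) * n) (\<mu> * n)) = 0\<^sub>m ((k - \<mu> - 1) * n) (\<mu> * n)"
    by (intro eq_matI) auto
  have "?f (lagrange_pencil n k \<mu> x Pc A B) = four_block_mat
      (?f (?M + const_mp A * ?K + transpose_mat ?H * const_mp B)) (?f (transpose_mat ?H)) (?f ?K)
      (?f (0\<^sub>m ((k - \<mu> - 1) * n) (\<mu> * n)))"
    unfolding lagrange_pencil_def
    by (rule map_four_block_mat[OF add_carrier_mat[OF HB] HT K zero_carrier_mat])
  then show ?thesis
    unfolding value_mp_eq_map_mat top zero transpose_map_mat[symmetric] map_K1Lag[OF mu] map_K2Lag g_def .
qed

section \<open>Eigenvectors of the pencil and of the Lagrange polynomial\<close>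

lemma smult_vec_nonzero:
  fixes v :: "'a::idom vec"
  assumes "v \<in> carrier_vec n" and "v \<noteq> 0\<^sub>v n" and "d \<noteq> 0"
  shows "d \<cdot>\<^sub>v v \<noteq> 0\<^sub>v n"
  using assms by (auto simp: vec_eq_iff)

lemma smult_mat_mult_smult_vec_eq_0:
  fixes S :: "'a::comm_ring_1 mat"
  assumes "S \<in> carrier_mat n n" and "v \<in> carrier_vec n" and "S *\<^sub>v v = 0\<^sub>v n"
  shows "(c \<cdot>\<^sub>m S) *\<^sub>v (d \<cdot>\<^sub>v v) = 0\<^sub>v n"
proof -
  have "(c \<cdot>\<^sub>m S) *\<^sub>v (d \<cdot>\<^sub>v v) = c \<cdot>\<^sub>v (d \<cdot>\<^sub>v (S *\<^sub>v v))"
    using assms(1,2) by (intro eq_vecI) auto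
  then show ?thesis using assms(3) by auto
qed

text \<open>Every block in question is a nonzero multiple of one kernel vector \<open>v\<close> of
  the sandwich or of its transpose. The right case applies \<open>block_kronecker_kernel\<close> to
  the value of the pencil, the left case to the transposed value, with the transposes of
  \<open>A\<close> and \<open>B\<close> interchanged.\<close>

lemma lagrange_pencil_eigenvectors:
  fixes x :: "nat \<Rightarrow> complex" and lam :: ext_complex
  assumes mu: "\<mu> < k" and Pc: "\<forall>i\<in>{1..k+1}. Pc i \<in> carrier_mat n n"
    and off: "off_nodes x k lam"
    and A: "A \<in> carrier_mat ((\<mu> + 1) * n) ((k - \<mu> - 1) * n)"
    and B: "B \<in> carrier_mat (\<mu> * n) ((k - \<mu>) * n)"
  defines "L \<equiv> lagrange_pencil n k \<mu> x Pc A B" and "P \<equiv> lagrange_mp n k x Pc"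
  shows "\<lbrakk>right_eigenvector_mp 1 L lam z; i \<in> {1..k-\<mu>}\<rbrakk> \<Longrightarrow> right_eigenvector_mp k P lam (block_entry n z i)"
    and "\<lbrakk>left_eigenvector_mp 1 L lam \<omega>; i \<in> {1..\<mu>+1}\<rbrakk> \<Longrightarrow> left_eigenvector_mp k P lam (block_entry n \<omega> i)"
proof -
  define g where "g = (\<lambda>i. point_value 1 lam (gam x i))"
  define p where "p = k - \<mu> - 1"
  have less_mu: "\<mu> < \<mu> + 1" by simp
  have p: "k - \<mu> = p + 1" "p < k" using mu by (simp_all add: p_def)
  let ?K = "bidiag n p k g" and ?H = "bidiag n \<mu> (\<mu> + 1) g"
  let ?C = "dual_col n p k g" and ?D = "dual_col n \<mu> (\<mu> + 1) g"
  let ?M = "map_mat (point_value 1 lam) (MLag n k \<mu> x Pc)"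
  let ?S = "transpose_mat ?D * ?M * ?C"
  have gk: "\<forall>i\<in>{1..k+1}. g i \<noteq> 0"
    using point_value_gam_nonzero[OF off] unfolding g_def by blast
  \<comment> \<open>The second bidiagonal matrix uses node indices up to \<open>\<mu> + 2\<close>,
    and \<open>\<mu> + 2 \<le> k + 1\<close>.\<close>
  then have gmu: "\<forall>i\<in>{1..\<mu>+1+1}. g i \<noteq> 0" using mu by auto
  have M: "?M \<in> carrier_mat ((\<mu> + 1) * n) ((p + 1) * n)"
    unfolding map_MLag[OF mu Pc] p(1) by (rule block_mat_carrier)
  have A': "A \<in> carrier_mat ((\<mu> + 1) * n) (p * n)" using A unfolding p_def .
  have B': "B \<in> carrier_mat (\<mu> * n) ((p + 1) * n)" using B unfolding p(1) .
  have K: "?K \<in> carrier_mat (p * n) ((p + 1) * n)"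
    and H: "?H \<in> carrier_mat (\<mu> * n) ((\<mu> + 1) * n)"
    by (rule bidiag_carrier)+
  have HT: "transpose_mat ?H \<in> carrier_mat ((\<mu> + 1) * n) (\<mu> * n)" using H by simp
  have C: "?C \<in> carrier_mat ((p + 1) * n) n" and D: "?D \<in> carrier_mat ((\<mu> + 1) * n) n"
    by (rule dual_col_carrier)+
  have DT: "transpose_mat ?D \<in> carrier_mat n ((\<mu> + 1) * n)" using D by simp
  note DM = mult_carrier_mat[OF DT M]
  have S: "?S \<in> carrier_mat n n" by (rule mult_carrier_mat[OF DM C])
  obtain c where V: "value_mp k P lam = c \<cdot>\<^sub>m ?S"
    using value_lagrange_eq_sandwich[OF mu Pc off] unfolding P_def g_def p_def by blast
  have dimP: "dim_row P = n" "dim_col P = n" by (simp_all add: P_def lagrange_mp_def)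
  have dimL: "dim_row L = (\<mu> + 1) * n + p * n" "dim_col L = (p + 1) * n + \<mu> * n"
    unfolding L_def lagrange_pencil_def K2Lag_def p_def[symmetric] p(1) using B'
    by (simp_all add: const_mp_def)
  note AK = mult_carrier_mat[OF A' K] and HB = mult_carrier_mat[OF HT B']
  let ?U = "?M + A * ?K + transpose_mat ?H * B"
  have U: "?U \<in> carrier_mat ((\<mu> + 1) * n) ((p + 1) * n)" by (rule add_carrier_mat[OF HB])
  have VL: "value_mp 1 L lam = four_block_mat ?U (transpose_mat ?H) ?K (0\<^sub>m (p * n) (\<mu> * n))"
    using value_lagrange_pencil[OF mu A B] unfolding L_def g_def p_def .
  show "right_eigenvector_mp k P lam (block_entry n z i)"
    if z: "right_eigenvector_mp 1 L lam z" and i: "i \<in> {1..k-\<mu>}"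
  proof -
    from z have z': "z \<in> carrier_vec ((p + 1) * n + \<mu> * n)" "z \<noteq> 0\<^sub>v ((p + 1) * n + \<mu> * n)"
      "four_block_mat ?U (transpose_mat ?H) ?K (0\<^sub>m (p * n) (\<mu> * n)) *\<^sub>v z = 0\<^sub>v ((\<mu> + 1) * n + p * n)"
      unfolding right_eigenvector_mp_def VL dimL by blast+
    obtain v where v: "v \<in> carrier_vec n" "v \<noteq> 0\<^sub>v n" "?S *\<^sub>v v = 0\<^sub>v n"
      and ze: "\<forall>i\<in>{1..p+1}. block_entry n z i = dual_coeff k g i \<cdot>\<^sub>v v"
      by (rule block_kronecker_kernel[OF p(2) less_mu gk gmu refl refl M A' B' z'])
    have d: "dual_coeff k g i \<noteq> 0"
      using dual_coeff_nonzero[OF p(2) gk] i p(1) by simp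
    show ?thesis
      unfolding right_eigenvector_mp_def dimP V bspec[OF ze i[unfolded p(1)]]
      by (intro conjI smult_carrier_vec[THEN iffD2, OF v(1)] smult_vec_nonzero[OF v(1,2) d]
        smult_mat_mult_smult_vec_eq_0[OF S v(1,3)])
  qed
  show "left_eigenvector_mp k P lam (block_entry n \<omega> i)"
    if w: "left_eigenvector_mp 1 L lam \<omega>" and i: "i \<in> {1..\<mu>+1}"
  proof -
    have MT: "transpose_mat ?M \<in> carrier_mat ((p + 1) * n) ((\<mu> + 1) * n)"
      and AT: "transpose_mat A \<in> carrier_mat (p * n) ((\<mu> + 1) * n)"
      and BT: "transpose_mat B \<in> carrier_mat ((p + 1) * n) (\<mu> * n)"
      and KT: "transpose_mat ?K \<in> carrier_mat ((p + 1) * n) (p * n)"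
      using M A' B' K by simp_all
    have "transpose_mat ?U = transpose_mat ?M + transpose_mat ?K * transpose_mat A
        + transpose_mat B * transpose_mat (transpose_mat ?H)"
      using transpose_add[OF add_carrier_mat[OF AK, of ?M] HB] transpose_add[OF M AK]
        transpose_mult[OF A' K] transpose_mult[OF HT B'] by simp
    \<comment> \<open>The summands are reordered because in the transposed pencil \<open>?H\<close>
      takes the role of \<open>K\<close> and \<open>transpose_mat B\<close> that of
      \<open>A\<close>.\<close>
    also have "\<dots> = transpose_mat ?M + transpose_mat B * ?H + transpose_mat ?K * transpose_mat A"
      unfolding transpose_transpose
        assoc_add_mat[OF MT mult_carrier_mat[OF KT AT] mult_carrier_mat[OF BT H]]
        assoc_add_mat[OF MT mult_carrier_mat[OF BT H] mult_carrier_mat[OF KT AT]]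
        comm_add_mat[OF mult_carrier_mat[OF KT AT] mult_carrier_mat[OF BT H]] ..
    finally have VLT: "transpose_mat (value_mp 1 L lam) = four_block_mat
        (transpose_mat ?M + transpose_mat B * ?H + transpose_mat ?K * transpose_mat A)
        (transpose_mat ?K) ?H (0\<^sub>m (\<mu> * n) (p * n))"
      unfolding VL using transpose_four_block_mat[OF U HT K zero_carrier_mat] by simp
    \<comment> \<open>The compression obtained from the transposed pencil is the transpose of the
      original one, so its kernel consists of left null vectors of \<open>?S\<close>.\<close>
    have ST: "transpose_mat ?C * transpose_mat ?M * ?D = transpose_mat ?S"
      using transpose_mult[OF DM C] transpose_mult[OF DT M]
        assoc_mult_mat[of "transpose_mat ?C" n "(p + 1) * n" "transpose_mat ?M" "(\<mu> + 1) * n" ?D n]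
        C MT D by simp
    from w have w': "\<omega> \<in> carrier_vec ((\<mu> + 1) * n + p * n)" "\<omega> \<noteq> 0\<^sub>v ((\<mu> + 1) * n + p * n)"
      "four_block_mat (transpose_mat ?M + transpose_mat B * ?H + transpose_mat ?K * transpose_mat A)
        (transpose_mat ?K) ?H (0\<^sub>m (\<mu> * n) (p * n)) *\<^sub>v \<omega> = 0\<^sub>v ((p + 1) * n + \<mu> * n)"
      unfolding left_eigenvector_mp_def VLT dimL by blast+
    obtain v where v: "v \<in> carrier_vec n" "v \<noteq> 0\<^sub>v n" "transpose_mat ?S *\<^sub>v v = 0\<^sub>v n"
      and we: "\<forall>i\<in>{1..\<mu>+1}. block_entry n \<omega> i = dual_coeff (\<mu> + 1) g i \<cdot>\<^sub>v v"
      unfolding ST[symmetric]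
      by (rule block_kronecker_kernel[OF less_mu p(2) gmu gk refl refl MT BT AT w'])
    have d: "dual_coeff (\<mu> + 1) g i \<noteq> 0"
      by (rule dual_coeff_nonzero[OF less_mu gmu i])
    have VT: "transpose_mat (value_mp k P lam) = c \<cdot>\<^sub>m transpose_mat ?S"
      unfolding V by (rule eq_matI) auto
    have S': "transpose_mat ?S \<in> carrier_mat n n" using S by simp
    show ?thesis
      unfolding left_eigenvector_mp_def dimP VT bspec[OF we i]
      by (intro conjI smult_carrier_vec[THEN iffD2, OF v(1)] smult_vec_nonzero[OF v(1,2) d]
        smult_mat_mult_smult_vec_eq_0[OF S' v(1,3)])
  qed
qed

theorem theorem4p9:
  fixes n k \<mu> :: nat
    and x :: "nat \<Rightarrow> complex"
    and Pc :: "nat \<Rightarrow> complex mat"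
    and P L :: matpoly
    and A B :: "complex mat"
    and lam0 :: ext_complex
    and z \<omega> :: "complex vec"
  assumes k: "k \<ge> 1"
    and mu: "\<mu> \<le> k - 1"
    and nodes: "inj_on x {1..k+1}"
    and coeffs: "\<And>i. i \<in> {1..k+1} \<Longrightarrow> Pc i \<in> carrier_mat n n"
    and P: "P = lagrange_mp n k x Pc"
    and regular: "regular_mp P"
    and eigenvalue: "eigenvalue_mp k P lam0"
    and A: "A \<in> carrier_mat ((\<mu> + 1) * n) ((k - \<mu> - 1) * n)"
    and B: "B \<in> carrier_mat (\<mu> * n) ((k - \<mu>) * n)"
    and L: "L = lagrange_pencil n k \<mu> x Pc A B"
    and z: "right_eigenvector_mp 1 L lam0 z"
    and \<omega>: "left_eigenvector_mp 1 L lam0 \<omega>"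
  shows "(\<forall>a. lam0 = Finite a \<and> a \<notin> x ` {1..k+1} \<longrightarrow>
            (\<forall>i\<in>{1..k-\<mu>}. right_eigenvector_mp k P lam0 (block_entry n z i)) \<and>
            (\<forall>i\<in>{1..\<mu>+1}. left_eigenvector_mp k P lam0 (block_entry n \<omega> i)))
       \<and> (lam0 = Infinite \<longrightarrow>
            (\<forall>i\<in>{1..k-\<mu>}. right_eigenvector_mp k P lam0 (block_entry n z i)) \<and>
            (\<forall>i\<in>{1..\<mu>+1}. left_eigenvector_mp k P lam0 (block_entry n \<omega> i)))"
proof -
  have mu': "\<mu> < k" using k mu by simp
  have coeffs': "\<forall>i\<in>{1..k+1}. Pc i \<in> carrier_mat n n" using coeffs by blast
  \<comment> \<open>The premise on the position of \<open>lam0\<close> is left open here and is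
    supplied separately for the finite and the infinite case.\<close>
  note ev = lagrange_pencil_eigenvectors[OF mu' coeffs' _ A B, where x = x and lam = lam0, folded P L]
  have fin: "off_nodes x k lam0" if "lam0 = Finite a" "a \<notin> x ` {1..k+1}" for a
    using that by (simp add: off_nodes_def)
  have inf: "off_nodes x k lam0" if "lam0 = Infinite"
    using that by (simp add: off_nodes_def)
  show ?thesis
    using ev(1)[OF _ z] ev(2)[OF _ \<omega>] fin inf by blast
qed

end
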